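(* For $(H,\Phi)\in\mathcal{X}(G)$ one has \begin{align*} e_{(H,\Phi)}^G & = \frac{1}{|N_G(H,\Phi)|} \sum_{K\le H} |K|\,\mu(K,H)\, [K,\mathrm{res}^H_K(e_\Phi^H)]_G\\ & = \frac{1}{|N_G(H,\Phi)|} \sum_{\substack{K\le H\\ \Phi|_{K^\perp}=1}} |K|\,\mu(K,H)\, [K,\mathrm{res}^H_K(e_\Phi^H)]_G\\ & =\frac{1}{|N_G(H,\Phi)|\cdot|H^*|}\sum_{\substack{K\le H\\ \Phi|_{K^\perp}=1}} \sum_{\phi\in H^*} |K|\,\mu(K,H)\,\Phi(\phi^{-1})\,[K,\phi|_K]_G\in B_{\mathbb{K}}^A(G), \end{align*} where $K^\perp:=\{\phi\in H^*\mid \phi|_K=1\}\le H^*$ and $\mu$ is the Möbius function on the poset of all subgroups of $G$.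
   Context: $A$ is a multiplicatively written abelian group; for a finite group $H$, $H^*:=\mathrm{Hom}(H,A)$ with pointwise multiplication. $G$ is a finite group such that $H^*$ is finite for every $H\le G$, and $\mathbb{K}$ is a field of characteristic zero which is a splitting field for $H^*$ for all $H\le G$. $\mathcal{M}(G)$ is the set of pairs $(U,\phi)$ with $U\le G$, $\phi\in U^*$; $G$ acts by ${}^g(U,\phi)=({}^gU,{}^g\phi)$ with ${}^gU=gUg^{-1}$, $({}^g\phi)(x)=\phi(g^{-1}xg)$; $[U,\phi]_G$ denotes the $G$-orbit of $(U,\phi)$. The $A$-fibered Burnside algebra $B^A_{\mathbb{K}}(G)$ is the $\mathbb{K}$-vector space with basis the set of these orbits and multiplication $[U,\phi]_G\cdot[V,\psi]_G=\sum_{g\in[U\backslash G/V]}[U\cap{}^gV,\phi|_{U\cap{}^gV}\cdot({}^g\psi)|_{U\cap{}^gV}]_G$. $\mathcal{X}(G)$ is the set of pairs $(H,\Phi)$ with $H\le G$ and $\Phi\in\mathrm{Hom}(H^*,\mathbb{K}^\times)$, with $G$-action ${}^g(H,\Phi)=({}^gH,{}^g\Phi)$, ${}^g\Phi(\phi)=\Phi({}^{g^{-1}}\phi)$; $N_G(H,\Phi)$ is the stabilizer of $(H,\Phi)$ in $G$. For $(H,\Phi)\in\mathcal{X}(G)$, $s^G_{(H,\Phi)}:=s^H_\Phi\circ\pi_H\circ\mathrm{res}^G_H\colon B^A_{\mathbb{K}}(G)\to\mathbb{K}$, where $\mathrm{res}^G_H([U,\phi]_G)=\sum_{g\in[H\backslash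 G/U]}[H\cap{}^gU,({}^g\phi)|_{H\cap{}^gU}]_H$; $\pi_H\colon B^A_{\mathbb{K}}(H)\to\mathbb{K}H^*$ maps $[U,\phi]_H$ to $\phi$ if $U=H$ and to $0$ otherwise; and $s^H_\Phi\colon\mathbb{K}H^*\to\mathbb{K}$ is the $\mathbb{K}$-linear extension of $\Phi$. The map $x\mapsto(s^G_{(H,\Phi)}(x))$ is a $\mathbb{K}$-algebra isomorphism from $B^A_{\mathbb{K}}(G)$ onto $(\prod_{(H,\Phi)\in\mathcal{X}(G)}\mathbb{K})^G$, and $e^G_{(H,\Phi)}\in B^A_{\mathbb{K}}(G)$ is the primitive idempotent determined by: $s^G_{(K,\Psi)}(e^G_{(H,\Phi)})=1$ if $(K,\Psi)$ is $G$-conjugate to $(H,\Phi)$, and $=0$ otherwise. $e_\Phi^H:=\frac{1}{|H^*|}\sum_{\phi\in H^*}\Phi(\phi^{-1})\phi\in\mathbb{K}H^*$. For $K\le H$, $\mathrm{res}^H_K\colon\mathbb{K}H^*\to\mathbb{K}K^*$ is the linear extension of $\phi\mapsto\phi|_K$. For $K\le G$ and $a=\sum_{\phi\in K^*}a_\phi\phi\in\mathbb{K}K^*$, $[K,a]_G:=\sum_{\phi\in K^*}a_\phi[K,\phi]_G$. *)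

theory Defs
  imports
    "HOL-Algebra.Algebra"
    "HOL-Library.Poly_Mapping"
    "Jordan_Normal_Form.VS_Connect"
begin

subsection \<open>Homomorphism groups and splitting fields\<close>

text \<open>
  Homomorphisms are made extensional, so that equality of functions is equality of homomorphisms.
  A subgroup \<open>U\<close> of \<open>G\<close> is turned into a group as \<open>G\<lparr>carrier := U\<rparr>\<close>; hence
  \<open>U\<^sup>*\<close> is \<open>hom_group (G\<lparr>carrier := U\<rparr>) A\<close>.
\<close>

definition hom_group :: "('g, 'm) monoid_scheme \<Rightarrow> ('a, 'n) monoid_scheme \<Rightarrow> ('g \<Rightarrow> 'a) monoid" where
  "hom_group H A =
    \<lparr>carrier = hom H A \<inter> extensional (carrier H),
     monoid.mult = (\<lambda>\<phi> \<psi>. \<lambda>x\<in>carrier H. \<phi> x \<otimes>\<^bsub>A\<^esub> \<psi> x),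
     one = (\<lambda>x\<in>carrier H. \<one>\<^bsub>A\<^esub>)\<rparr>"

abbreviation sub_dual ::
    "('g, 'm) monoid_scheme \<Rightarrow> ('a, 'n) monoid_scheme \<Rightarrow> 'g set \<Rightarrow> ('g \<Rightarrow> 'a) monoid" where
  "sub_dual G A U \<equiv> hom_group (G\<lparr>carrier := U\<rparr>) A"

abbreviation field_units :: "'k::field itself \<Rightarrow> 'k monoid" where
  "field_units K \<equiv> units_of (class_ring :: 'k ring)"

definition irreducible_rep :: "('c, 'm) monoid_scheme \<Rightarrow> nat \<Rightarrow> ('c \<Rightarrow> 'k::field mat) \<Rightarrow> bool" where
  "irreducible_rep C n \<rho> \<longleftrightarrow>
    \<rho> \<in> hom C (units_of (ring_mat TYPE('k) n ())) \<and> n > 0 \<and>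
    (\<forall>W. subspace class_ring W (module_vec TYPE('k) n) \<longrightarrow>
         (\<forall>g\<in>carrier C. \<forall>w\<in>W. \<rho> g *\<^sub>v w \<in> W) \<longrightarrow>
         W = {0\<^sub>v n} \<or> W = carrier_vec n)"

text \<open>
  The field \<open>K\<close> is a splitting field for the finite group \<open>C\<close> if \<open>End(V) = K\<close> for every
  simple \<open>KC\<close>-module \<open>V\<close>, where modules are given as matrix representations.
\<close>

definition splitting_field :: "'k::field itself \<Rightarrow> ('c, 'm) monoid_scheme \<Rightarrow> bool" where
  "splitting_field K C \<longleftrightarrow>
    (\<forall>n (\<rho> :: 'c \<Rightarrow> 'k mat). irreducible_rep C n \<rho> \<longrightarrow>
      (\<forall>T\<in>carrier_mat n n. (\<forall>g\<in>carrier C. T * \<rho> g = \<rho> g * T) \<longrightarrow> (\<exists>c. T = c \<cdot>\<^sub>m 1\<^sub>m n)))"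


subsection \<open>Free vector spaces\<close>

text \<open>
  The vector space with basis \<open>B\<close> consists of the finitely supported functions whose support
  (\<open>Poly_Mapping.keys\<close>) lies in \<open>B\<close>.
\<close>

definition scale :: "'k::field \<Rightarrow> ('b \<Rightarrow>\<^sub>0 'k) \<Rightarrow> ('b \<Rightarrow>\<^sub>0 'k)" where
  "scale c x = Poly_Mapping.map (\<lambda>a. c * a) x"

definition linear_ext :: "('b \<Rightarrow> ('c \<Rightarrow>\<^sub>0 'k)) \<Rightarrow> ('b \<Rightarrow>\<^sub>0 'k) \<Rightarrow> ('c \<Rightarrow>\<^sub>0 'k::field)" where
  "linear_ext f x = (\<Sum>b\<in>Poly_Mapping.keys x. scale (Poly_Mapping.lookup x b) (f b))"


subsection \<open>Conjugation\<close>

definition conj_set :: "('g, 'm) monoid_scheme \<Rightarrow> 'g \<Rightarrow> 'g set \<Rightarrow> 'g set" where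
  "conj_set G g U = g <#\<^bsub>G\<^esub> U #>\<^bsub>G\<^esub> (inv\<^bsub>G\<^esub> g)"

definition conj_hom :: "('g, 'm) monoid_scheme \<Rightarrow> 'g \<Rightarrow> 'g set \<Rightarrow> ('g \<Rightarrow> 'a) \<Rightarrow> 'g \<Rightarrow> 'a" where
  "conj_hom G g U \<phi> = (\<lambda>x\<in>conj_set G g U. \<phi> (inv\<^bsub>G\<^esub> g \<otimes>\<^bsub>G\<^esub> x \<otimes>\<^bsub>G\<^esub> g))"

definition double_cosets :: "('g, 'm) monoid_scheme \<Rightarrow> 'g set \<Rightarrow> 'g set \<Rightarrow> 'g set set" where
  "double_cosets G U V = {U <#>\<^bsub>G\<^esub> (g <#\<^bsub>G\<^esub> V) | g. g \<in> carrier G}"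

definition double_coset_reps :: "('g, 'm) monoid_scheme \<Rightarrow> 'g set \<Rightarrow> 'g set \<Rightarrow> 'g set" where
  "double_coset_reps G U V = (\<lambda>D. SOME g. g \<in> D) ` double_cosets G U V"


subsection \<open>The fibered Burnside algebra\<close>

type_synonym ('g, 'a) mpair = "'g set \<times> ('g \<Rightarrow> 'a)"

definition mpairs :: "('g, 'm) monoid_scheme \<Rightarrow> ('a, 'n) monoid_scheme \<Rightarrow> ('g, 'a) mpair set" where
  "mpairs G A = {(U, \<phi>). subgroup U G \<and> \<phi> \<in> carrier (sub_dual G A U)}"

definition mconj :: "('g, 'm) monoid_scheme \<Rightarrow> 'g \<Rightarrow> ('g, 'a) mpair \<Rightarrow> ('g, 'a) mpair" where
  "mconj G g = (\<lambda>(U, \<phi>). (conj_set G g U, conj_hom G g U \<phi>))"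

type_synonym ('g, 'a, 'k) burnside = "('g, 'a) mpair set \<Rightarrow>\<^sub>0 'k"

definition orbit_elem ::
    "('g, 'm) monoid_scheme \<Rightarrow> 'g set \<Rightarrow> ('g \<Rightarrow> 'a) \<Rightarrow> ('g, 'a, 'k::field) burnside" where
  "orbit_elem G U \<phi> = Poly_Mapping.single (orbit G (mconj G) (U, \<phi>)) 1"

text \<open>
  Linear maps on the algebra are prescribed on \<open>[U, \<phi>]\<close> and extended linearly, evaluating the
  prescription at an arbitrarily chosen representative of each orbit.
\<close>

definition orbit_ext ::
    "('g set \<Rightarrow> ('g \<Rightarrow> 'a) \<Rightarrow> ('c \<Rightarrow>\<^sub>0 'k)) \<Rightarrow> ('g, 'a, 'k) burnside \<Rightarrow> ('c \<Rightarrow>\<^sub>0 'k::field)" where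
  "orbit_ext f = linear_ext (\<lambda>ob. case (SOME p. p \<in> ob) of (U, \<phi>) \<Rightarrow> f U \<phi>)"

definition burnside_mult ::
    "('g, 'm) monoid_scheme \<Rightarrow> ('a, 'n) monoid_scheme \<Rightarrow>
     ('g, 'a, 'k::field) burnside \<Rightarrow> ('g, 'a, 'k) burnside \<Rightarrow> ('g, 'a, 'k) burnside" where
  "burnside_mult G A x y =
    orbit_ext (\<lambda>U \<phi>. orbit_ext (\<lambda>V \<psi>.
      \<Sum>g\<in>double_coset_reps G U V.
        orbit_elem G (U \<inter> conj_set G g V)
          (\<lambda>z\<in>U \<inter> conj_set G g V. \<phi> z \<otimes>\<^bsub>A\<^esub> conj_hom G g V \<psi> z)) y) x"

definition burnside_algebra ::
    "'k::field itself \<Rightarrow> ('g, 'm) monoid_scheme \<Rightarrow> ('a, 'n) monoid_scheme \<Rightarrow>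
     ('g, 'a, 'k) burnside ring" where
  "burnside_algebra K G A =
    \<lparr>carrier = {x. Poly_Mapping.keys x \<subseteq> orbits G (mpairs G A) (mconj G)},
     monoid.mult = burnside_mult G A,
     one = orbit_elem G (carrier G) (\<lambda>x\<in>carrier G. \<one>\<^bsub>A\<^esub>),
     ring.zero = 0,
     ring.add = (+)\<rparr>"


subsection \<open>The species and the primitive idempotents\<close>

type_synonym ('g, 'a, 'k) xpair = "'g set \<times> (('g \<Rightarrow> 'a) \<Rightarrow> 'k)"

definition xpairs ::
    "('g, 'm) monoid_scheme \<Rightarrow> ('a, 'n) monoid_scheme \<Rightarrow> ('g, 'a, 'k::field) xpair set" where
  "xpairs G A =
    {(H, \<Phi>). subgroup H G \<and> \<Phi> \<in> carrier (hom_group (sub_dual G A H) (field_units TYPE('k)))}"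

definition xconj ::
    "('g, 'm) monoid_scheme \<Rightarrow> ('a, 'n) monoid_scheme \<Rightarrow> 'g \<Rightarrow>
     ('g, 'a, 'k) xpair \<Rightarrow> ('g, 'a, 'k) xpair" where
  "xconj G A g = (\<lambda>(H, \<Phi>).
    (conj_set G g H,
     \<lambda>\<phi>\<in>carrier (sub_dual G A (conj_set G g H)).
       \<Phi> (conj_hom G (inv\<^bsub>G\<^esub> g) (conj_set G g H) \<phi>)))"

definition burnside_res ::
    "('g, 'm) monoid_scheme \<Rightarrow> 'g set \<Rightarrow> ('g, 'a, 'k::field) burnside \<Rightarrow> ('g, 'a, 'k) burnside" where
  "burnside_res G H = orbit_ext (\<lambda>U \<phi>.
    \<Sum>g\<in>double_coset_reps G H U.
      orbit_elem (G\<lparr>carrier := H\<rparr>) (H \<inter> conj_set G g U)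
        (restrict (conj_hom G g U \<phi>) (H \<inter> conj_set G g U)))"

definition burnside_proj ::
    "'g set \<Rightarrow> ('g, 'a, 'k::field) burnside \<Rightarrow> (('g \<Rightarrow> 'a) \<Rightarrow>\<^sub>0 'k)" where
  "burnside_proj H = orbit_ext (\<lambda>U \<phi>. if U = H then Poly_Mapping.single \<phi> 1 else 0)"

definition dual_eval :: "(('g \<Rightarrow> 'a) \<Rightarrow> 'k) \<Rightarrow> (('g \<Rightarrow> 'a) \<Rightarrow>\<^sub>0 'k) \<Rightarrow> 'k::field" where
  "dual_eval \<Phi> a = (\<Sum>\<phi>\<in>Poly_Mapping.keys a. Poly_Mapping.lookup a \<phi> * \<Phi> \<phi>)"

definition species ::
    "('g, 'm) monoid_scheme \<Rightarrow> ('g, 'a, 'k::field) xpair \<Rightarrow> ('g, 'a, 'k) burnside \<Rightarrow> 'k" where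
  "species G = (\<lambda>(H, \<Phi>) x. dual_eval \<Phi> (burnside_proj H (burnside_res G H x)))"

text \<open>
  Since the family of all species is an algebra isomorphism onto the \<open>G\<close>-fixed points of a
  product of copies of \<open>K\<close>, the species values determine the idempotent.
\<close>

definition prim_idem ::
    "('g, 'm) monoid_scheme \<Rightarrow> ('a, 'n) monoid_scheme \<Rightarrow> ('g, 'a, 'k::field) xpair \<Rightarrow>
     ('g, 'a, 'k) burnside" where
  "prim_idem G A p = (THE e. e \<in> carrier (burnside_algebra TYPE('k) G A) \<and>
    (\<forall>q\<in>xpairs G A. species G q e = (if q \<in> orbit G (xconj G A) p then 1 else 0)))"


subsection \<open>The ingredients of the idempotent formula\<close>

definition dual_idem ::
    "('g, 'm) monoid_scheme \<Rightarrow> ('a, 'n) monoid_scheme \<Rightarrow> 'g set \<Rightarrow> (('g \<Rightarrow> 'a) \<Rightarrow> 'k) \<Rightarrow>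
     (('g \<Rightarrow> 'a) \<Rightarrow>\<^sub>0 'k::field)" where
  "dual_idem G A H \<Phi> = scale (1 / of_nat (card (carrier (sub_dual G A H))))
    (\<Sum>\<phi>\<in>carrier (sub_dual G A H). Poly_Mapping.single \<phi> (\<Phi> (inv\<^bsub>sub_dual G A H\<^esub> \<phi>)))"

definition dual_res :: "'g set \<Rightarrow> (('g \<Rightarrow> 'a) \<Rightarrow>\<^sub>0 'k) \<Rightarrow> (('g \<Rightarrow> 'a) \<Rightarrow>\<^sub>0 'k::field)" where
  "dual_res K = linear_ext (\<lambda>\<phi>. Poly_Mapping.single (restrict \<phi> K) 1)"

definition orbit_elem_lin ::
    "('g, 'm) monoid_scheme \<Rightarrow> ('a, 'n) monoid_scheme \<Rightarrow> 'g set \<Rightarrow> (('g \<Rightarrow> 'a) \<Rightarrow>\<^sub>0 'k) \<Rightarrow>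
     ('g, 'a, 'k::field) burnside" where
  "orbit_elem_lin G A K a =
    (\<Sum>\<phi>\<in>carrier (sub_dual G A K). scale (Poly_Mapping.lookup a \<phi>) (orbit_elem G K \<phi>))"

definition perp ::
    "('g, 'm) monoid_scheme \<Rightarrow> ('a, 'n) monoid_scheme \<Rightarrow> 'g set \<Rightarrow> 'g set \<Rightarrow> ('g \<Rightarrow> 'a) set" where
  "perp G A H K = {\<phi> \<in> carrier (sub_dual G A H). \<forall>x\<in>K. \<phi> x = \<one>\<^bsub>A\<^esub>}"

text \<open>The Moebius function of a finite poset \<open>P\<close>; for infinite \<open>P\<close> the value is irrelevant.\<close>

function moebius :: "'p::order set \<Rightarrow> 'p \<Rightarrow> 'p \<Rightarrow> int" where
  "moebius P x y =
    (if x = y then 1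
     else if finite P \<and> x < y then - (\<Sum>z\<in>{z \<in> P. x \<le> z \<and> z < y}. moebius P x z)
     else 0)"
  by auto
termination
proof (relation "measure (\<lambda>(P, x, y). card {z \<in> P. z < y})")
  fix P :: "'p::order set" and x y z
  assume "x \<noteq> y" and P: "finite P \<and> x < y" and z: "z \<in> {z \<in> P. x \<le> z \<and> z < y}"
  have "{w \<in> P. w < z} \<subset> {w \<in> P. w < y}"
    using z by auto
  then have "card {w \<in> P. w < z} < card {w \<in> P. w < y}"
    using P by (intro psubset_card_mono) auto
  then show "((P, x, z), (P, x, y)) \<in> measure (\<lambda>(P, x, y). card {z \<in> P. z < y})"
    by simp
qed simp

declare moebius.simps [simp del]

end

theory Submission
  imports Defs "HOL-Library.Function_Algebras"
begin

text \<open>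
  The species separate the elements of the algebra, so the idempotent is determined by its species
  values, and it suffices to compute the species of the right-hand side.

  \<^bold>\<open>Species are jointly injective\<close> (\<open>species_jointly_injective\<close>). On a basis element,
  \<open>s\<^sub>(\<^sub>H\<^sub>,\<^sub>\<Phi>\<^sub>)[U, \<phi>]\<close> is \<open>1 / |U|\<close> times the sum of the values of \<open>\<Phi>\<close> at the
  conjugates of \<open>\<phi>\<close> by those \<open>g\<close> with \<open>H \<subseteq> g U g\<^sup>-\<^sup>1\<close> (\<open>species_orbit_elem\<close>). Hence species are
  triangular with respect to the orders of subgroups, and what is left is that the characters of
  each \<open>H\<^sup>*\<close> separate the elements of the group algebra (\<open>characters_jointly_faithful\<close>).
  This is the point that needs a splitting field: simple modules of an abelian group over a
  splitting field are one-dimensional (\<open>splitting_field_common_eigenvector\<close>), and a suitable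
  submodule of the functions on the group therefore contains a character that is nontrivial at a
  prescribed element (\<open>character_separating\<close>).

  \<^bold>\<open>The species of the sum\<close> (\<open>species_moebius_sum\<close>). Interchanging summations, the sum over \<open>K\<close>
  becomes a sum of Moebius values over an interval ending in \<open>H\<close> and picks out the \<open>g\<close> with
  \<open>L = g H g\<^sup>-\<^sup>1\<close> (\<open>sum_moebius_conj_into\<close>). The sum over \<open>H\<^sup>*\<close> is then an orthogonality relation for
  characters and picks out the \<open>g\<close> conjugating \<open>(H, \<Phi>)\<close> to \<open>(L, \<Psi>)\<close>. There are \<open>|N\<^sub>G(H, \<Phi>)|\<close> of them,
  or none.

  \<^bold>\<open>Omitting subgroups\<close> (\<open>twisted_sum_eq_zero\<close>). If \<open>\<Phi>\<close> is nontrivial on \<open>K\<^sup>\<bottom>\<close>, the term of \<open>K\<close>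
  is invariant under multiplication by a scalar other than 1, so it vanishes.
\<close>

section \<open>Representations of abelian groups over a splitting field\<close>

text \<open>
  The dimension is minimised among the nonzero subspaces with the property \<open>Inv\<close>. The ambient
  space may be infinite-dimensional, so finiteness comes from the finite set \<open>S\<close> spanning \<open>W\<close>.
\<close>

lemma (in vector_space) minimal_subspace_with:
  assumes W: "subspace W" "W \<noteq> {0}" "W \<subseteq> span S" "finite S" and Inv: "Inv W"
  obtains M B where "subspace M" "M \<noteq> {0}" "M \<subseteq> W" "Inv M"
    "finite B" "independent B" "span B = M"
    "\<And>M'. subspace M' \<Longrightarrow> M' \<noteq> {0} \<Longrightarrow> M' \<subseteq> M \<Longrightarrow> Inv M' \<Longrightarrow> M' = M"
proof -
  define P where "P M \<longleftrightarrow> subspace M \<and> M \<noteq> {0} \<and> M \<subseteq> W \<and> Inv M" for M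
  define M where "M = arg_min dim P"
  have PM: "P M" and M_min: "dim M \<le> dim M'" if "P M'" for M'
  proof -
    have "P W" using W Inv by (auto simp: P_def)
    then show "P M" unfolding M_def by (rule arg_min_natI)
    show "dim M \<le> dim M'" unfolding M_def using that by (rule arg_min_nat_le)
  qed
  have PW: "P W" using W Inv by (auto simp: P_def)
  have fin: "finite B" if "independent B" "B \<subseteq> W" for B
    using independent_span_bound[OF W(4) that(1)] that(2) W(3) by blast
  obtain B where B: "B \<subseteq> M" "independent B" "M \<subseteq> span B" "card B = dim M"
    using basis_exists[of M] by blast
  have MW: "M \<subseteq> W" and sM: "subspace M" using PM[OF PW] by (auto simp: P_def)
  have finB: "finite B" using B MW fin by blast
  have spB: "span B = M"
    using B sM by (simp add: span_minimal subset_antisym)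
  have eq: "M' = M" if M': "subspace M'" "M' \<noteq> {0}" "M' \<subseteq> M" "Inv M'" for M'
  proof (rule ccontr)
    assume "M' \<noteq> M"
    then obtain x where x: "x \<in> M" "x \<notin> M'" using M'(3) by blast
    have "P M'" using M' MW by (auto simp: P_def)
    then have le: "dim M \<le> dim M'" using M_min by blast
    obtain B' where B': "B' \<subseteq> M'" "independent B'" "M' \<subseteq> span B'" "card B' = dim M'"
      using basis_exists[of M'] by blast
    have finB': "finite B'" using B' M'(3) MW fin by blast
    have "span B' = M'" using B' M'(1) by (simp add: span_minimal subset_antisym)
    then have "x \<notin> span B'" using x by blast
    then have ind: "independent (insert x B')" using B'(2) by (rule independent_insertI)
    have "insert x B' \<subseteq> span B" using x B'(1) M'(3) spB by blast
    then have "card (insert x B') \<le> card B"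
      using independent_span_bound[OF finB ind] by blast
    moreover have "x \<notin> B'" using x B'(1) by blast
    ultimately show False using finB' B(4) B'(4) le by simp
  qed
  show thesis
    using that[of M B] PM[OF PW] finB B(2) spB eq by (auto simp: P_def)
qed

lemma mat_eq_if_mult_vec_eq:
  fixes P Q :: "'a::comm_ring_1 mat"
  assumes "P \<in> carrier_mat n n" "Q \<in> carrier_mat n n"
    and "\<And>v. v \<in> carrier_vec n \<Longrightarrow> P *\<^sub>v v = Q *\<^sub>v v"
  shows "P = Q"
proof (rule eq_matI)
  fix i j assume ij: "i < dim_row Q" "j < dim_col Q"
  have "(P *\<^sub>v unit_vec n j) $ i = (Q *\<^sub>v unit_vec n j) $ i"
    by (simp add: assms(3))
  then show "P $$ (i, j) = Q $$ (i, j)"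
    using ij assms(1,2) by (simp add: scalar_prod_right_unit)
qed (use assms(1,2) in auto)

text \<open>
  A minimal invariant subspace becomes an irreducible matrix representation once a basis is chosen.
  As \<open>C\<close> is abelian, every group element acts by an endomorphism of that representation, hence
  by a scalar. So every vector of the minimal subspace is a common eigenvector. The laws of an
  action are required on \<open>W\<close> only, which admits translations of functions extended by zero
  outside a group.
\<close>

lemma (in vector_space) splitting_field_common_eigenvector:
  fixes C :: "('c, 'n) monoid_scheme" and act :: "'c \<Rightarrow> 'b \<Rightarrow> 'b"
  assumes C: "comm_group C" and split: "splitting_field TYPE('a) C"
    and W: "subspace W" "W \<noteq> {0}" "W \<subseteq> span S" "finite S"
    and inv: "\<And>g w. g \<in> carrier C \<Longrightarrow> w \<in> W \<Longrightarrow> act g w \<in> W"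
    and add: "\<And>g v w. g \<in> carrier C \<Longrightarrow> v \<in> W \<Longrightarrow> w \<in> W \<Longrightarrow> act g (v + w) = act g v + act g w"
    and scl: "\<And>g c w. g \<in> carrier C \<Longrightarrow> w \<in> W \<Longrightarrow> act g (c *s w) = c *s act g w"
    and mult: "\<And>g h w. g \<in> carrier C \<Longrightarrow> h \<in> carrier C \<Longrightarrow> w \<in> W \<Longrightarrow>
                 act (g \<otimes>\<^bsub>C\<^esub> h) w = act g (act h w)"
    and one: "\<And>w. w \<in> W \<Longrightarrow> act \<one>\<^bsub>C\<^esub> w = w"
  obtains w where "w \<in> W" "w \<noteq> 0" "\<And>g. g \<in> carrier C \<Longrightarrow> \<exists>c. act g w = c *s w"
proof -
  interpret C: comm_group C by fact
  define Inv where "Inv M \<longleftrightarrow> (\<forall>g\<in>carrier C. \<forall>w\<in>M. act g w \<in> M)" for M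
  have "Inv W" using inv by (auto simp: Inv_def)
  then obtain M B where M: "subspace M" "M \<noteq> {0}" "M \<subseteq> W" "Inv M"
      and B: "finite B" "independent B" "span B = M"
      and min: "\<And>M'. subspace M' \<Longrightarrow> M' \<noteq> {0} \<Longrightarrow> M' \<subseteq> M \<Longrightarrow> Inv M' \<Longrightarrow> M' = M"
    using minimal_subspace_with[OF W, of Inv] by blast
  define n where "n = card B"
  obtain b where b: "bij_betw b {..<n} B"
    using ex_bij_betw_nat_finite[OF B(1)] by (auto simp: n_def atLeast0LessThan)
  have "B \<noteq> {}" using M(2) B(3) by auto
  then have n: "n > 0" using B(1) by (simp add: n_def card_gt_0_iff)
  have bB: "b i \<in> B" if "i < n" for i using b that by (auto simp: bij_betw_def)
  have BM: "B \<subseteq> M" using B(3) span_superset by blast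
  have bM: "b i \<in> M" if "i < n" for i using bB[OF that] BM by blast
  \<comment> \<open>\<open>F\<close> is the coordinate isomorphism from column vectors onto \<open>M\<close>, \<open>crd\<close> its inverse, and
    \<open>\<rho>\<close> the action transported along it.\<close>
  define F where "F v = (\<Sum>i<n. (v $ i) *s b i)" for v
  define crd where "crd w = vec n (\<lambda>i. representation B w (b i))" for w
  define \<rho> where "\<rho> g = mat n n (\<lambda>(i, j). representation B (act g (b j)) (b i))" for g
  have reindex: "(\<Sum>i<n. f (b i)) = sum f B" for f :: "'b \<Rightarrow> 'b"
    using sum.reindex_bij_betw[OF b] .
  have Fcrd: "F (crd w) = w" if "w \<in> M" for w
  proof -
    have "F (crd w) = (\<Sum>i<n. representation B w (b i) *s b i)"
      by (simp add: F_def crd_def)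
    also have "\<dots> = (\<Sum>x\<in>B. representation B w x *s x)"
      by (rule reindex)
    also have "\<dots> = w" using sum_representation_eq[OF B(2) _ B(1)] that B(3) by simp
    finally show ?thesis .
  qed
  have FM: "F v \<in> M" for v
    unfolding F_def using M(1) bM by (auto intro!: subspace_sum subspace_scale)
  have crd_F: "crd (F v) = v" if v: "v \<in> carrier_vec n" for v
  proof (rule eq_vecI)
    fix i assume "i < dim_vec v"
    then have i: "i < n" using v by simp
    have "representation B (F v) (b i) = (\<Sum>j<n. representation B (v $ j *s b j) (b i))"
      unfolding F_def using B(2,3) bM M(1) by (subst representation_sum) (auto intro: subspace_scale)
    also have "\<dots> = (\<Sum>j<n. v $ j * (if b j = b i then 1 else 0))"
      by (intro sum.cong refl)
        (use B(2,3) bM bB in \<open>auto simp: representation_scale representation_basis\<close>)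
    also have "\<dots> = (\<Sum>j<n. if j = i then v $ i else 0)"
      by (intro sum.cong refl) (use b i in \<open>auto simp: bij_betw_def inj_on_def\<close>)
    also have "\<dots> = v $ i" using i by simp
    finally show "crd (F v) $ i = v $ i" using i by (simp add: crd_def)
  qed (use v in \<open>auto simp: crd_def\<close>)
  have F_inj: "v = w" if "F v = F w" "v \<in> carrier_vec n" "w \<in> carrier_vec n" for v w
    using crd_F that by metis
  have F_add: "F (v + w) = F v + F w" if "v \<in> carrier_vec n" "w \<in> carrier_vec n" for v w
    using that by (simp add: F_def scale_left_distrib sum.distrib)
  have F_smult: "F (c \<cdot>\<^sub>v v) = c *s F v" if "v \<in> carrier_vec n" for c v
    using that by (simp add: F_def scale_sum_right)
  have F_zero: "F (0\<^sub>v n) = 0" by (simp add: F_def)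
  have \<rho>_carrier: "\<rho> g \<in> carrier_mat n n" for g by (simp add: \<rho>_def)
  have act_sum: "act g (\<Sum>i\<in>I. c i *s b i) = (\<Sum>i\<in>I. c i *s act g (b i))"
    if g: "g \<in> carrier C" and I: "I \<subseteq> {..<n}" for g I c
  proof -
    have "finite I" using I finite_subset by blast
    then show ?thesis using I
    proof (induction I)
      case empty
      have "0 \<in> W" using W(1) by (rule subspace_0)
      then have "act g (0 *s 0) = 0 *s act g 0" using scl[OF g, of 0 0] by blast
      then show ?case by simp
    next
      case (insert i I)
      have "b i \<in> W" using insert.prems bM M(3) by auto
      moreover have "(\<Sum>i\<in>I. c i *s b i) \<in> W"
        using insert.prems bM M(3) W(1) by (intro subspace_sum subspace_scale) auto
      ultimately show ?case
        using insert W(1) by (simp add: add[OF g] scl[OF g] subspace_scale)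
    qed
  qed
  have F_act: "F (\<rho> g *\<^sub>v v) = act g (F v)" if g: "g \<in> carrier C" and v: "v \<in> carrier_vec n" for g v
  proof -
    have gM: "act g (b j) \<in> M" if "j < n" for j
      using M(4) g bM[OF that] by (auto simp: Inv_def)
    have "F (\<rho> g *\<^sub>v v) = (\<Sum>i<n. (\<Sum>j<n. representation B (act g (b j)) (b i) * v $ j) *s b i)"
      using v by (auto simp: F_def \<rho>_def scalar_prod_def atLeast0LessThan intro!: sum.cong)
    also have "\<dots> = (\<Sum>i<n. \<Sum>j<n. (v $ j) *s (representation B (act g (b j)) (b i) *s b i))"
      by (simp add: scale_sum_left mult.commute)
    also have "\<dots> = (\<Sum>j<n. \<Sum>i<n. (v $ j) *s (representation B (act g (b j)) (b i) *s b i))"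
      by (rule sum.swap)
    also have "\<dots> = (\<Sum>j<n. (v $ j) *s F (crd (act g (b j))))"
      by (simp add: F_def crd_def scale_sum_right)
    also have "\<dots> = (\<Sum>j<n. (v $ j) *s act g (b j))"
      using Fcrd gM by (intro sum.cong) auto
    also have "\<dots> = act g (F v)" unfolding F_def by (rule act_sum[OF g, symmetric]) simp
    finally show ?thesis .
  qed
  have \<rho>_mult: "\<rho> (g \<otimes>\<^bsub>C\<^esub> h) = \<rho> g * \<rho> h" if gh: "g \<in> carrier C" "h \<in> carrier C" for g h
  proof (rule mat_eq_if_mult_vec_eq[of _ n])
    fix v :: "'a vec" assume v: "v \<in> carrier_vec n"
    have hv: "\<rho> h *\<^sub>v v \<in> carrier_vec n" using \<rho>_carrier v by (metis mult_mat_vec_carrier)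
    have "F (\<rho> (g \<otimes>\<^bsub>C\<^esub> h) *\<^sub>v v) = act g (act h (F v))"
      using gh v FM M(3) by (subst F_act) (auto intro: mult)
    also have "\<dots> = F (\<rho> g *\<^sub>v (\<rho> h *\<^sub>v v))" using gh v hv by (simp add: F_act)
    finally show "\<rho> (g \<otimes>\<^bsub>C\<^esub> h) *\<^sub>v v = \<rho> g * \<rho> h *\<^sub>v v"
      using F_inj[OF _ mult_mat_vec_carrier[OF \<rho>_carrier v] mult_mat_vec_carrier[OF \<rho>_carrier hv]]
      by (simp add: assoc_mult_mat_vec[OF \<rho>_carrier \<rho>_carrier v])
  qed (use \<rho>_carrier in \<open>auto intro: mult_carrier_mat\<close>)
  have \<rho>_one: "\<rho> \<one>\<^bsub>C\<^esub> = 1\<^sub>m n"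
  proof (rule mat_eq_if_mult_vec_eq[of _ n])
    fix v :: "'a vec" assume v: "v \<in> carrier_vec n"
    have "F (\<rho> \<one>\<^bsub>C\<^esub> *\<^sub>v v) = F v" using v FM M(3) by (subst F_act) (auto intro: one)
    then show "\<rho> \<one>\<^bsub>C\<^esub> *\<^sub>v v = 1\<^sub>m n *\<^sub>v v"
      using F_inj[OF _ mult_mat_vec_carrier[OF \<rho>_carrier v] v] v by simp
  qed (use \<rho>_carrier in auto)
  have "irreducible_rep C n \<rho>"
    unfolding irreducible_rep_def
  proof (intro conjI allI impI)
    have "\<rho> g \<in> Units (ring_mat TYPE('a) n ())" if g: "g \<in> carrier C" for g
    proof -
      have "\<rho> g * \<rho> (inv\<^bsub>C\<^esub> g) = 1\<^sub>m n" "\<rho> (inv\<^bsub>C\<^esub> g) * \<rho> g = 1\<^sub>m n"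
        using g by (simp_all flip: \<rho>_mult add: \<rho>_one)
      then show ?thesis using \<rho>_carrier by (auto simp: Units_def ring_mat_def)
    qed
    then show "\<rho> \<in> hom C (units_of (ring_mat TYPE('a) n ()))"
      by (auto simp: hom_def units_of_def ring_mat_def \<rho>_mult)
    show "n > 0" by fact
  next
    fix V assume V: "VectorSpace.subspace class_ring V (module_vec TYPE('a) n)"
      and V_inv: "\<forall>g\<in>carrier C. \<forall>w\<in>V. \<rho> g *\<^sub>v w \<in> V"
    interpret V: submodule class_ring V "module_vec TYPE('a) n"
      using V by (simp add: VectorSpace.subspace_def)
    have Vc: "V \<subseteq> carrier_vec n" using V.subset by (simp add: module_vec_simps)
    have V_add: "v + w \<in> V" if "v \<in> V" "w \<in> V" for v w
      using V.m_closed[OF that] by (simp add: module_vec_simps)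
    have V_zero: "0\<^sub>v n \<in> V" using V.zero_closed by (simp add: module_vec_simps)
    have V_smult: "c \<cdot>\<^sub>v v \<in> V" if "v \<in> V" for c v
      using V.smult_closed[of c v] that by (simp add: module_vec_simps)
    have FV: "subspace (F ` V)"
    proof (rule subspaceI)
      show "0 \<in> F ` V" using V_zero F_zero by (metis image_eqI)
      show "x + y \<in> F ` V" if xy: "x \<in> F ` V" "y \<in> F ` V" for x y
      proof -
        obtain v w where "v \<in> V" "w \<in> V" "x = F v" "y = F w" using xy by blast
        then show ?thesis using F_add[of v w] V_add[of v w] Vc by (metis image_eqI subsetD)
      qed
      show "c *s x \<in> F ` V" if x: "x \<in> F ` V" for c x
      proof -
        obtain v where "v \<in> V" "x = F v" using x by blast
        then show ?thesis using F_smult[of v c] V_smult[of v c] Vc by (metis image_eqI subsetD)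
      qed
    qed
    have "Inv (F ` V)"
      unfolding Inv_def using V_inv Vc by (force simp flip: F_act)
    then consider "F ` V = {0}" | "F ` V = M" using min[OF FV] FM by blast
    then show "V = {0\<^sub>v n} \<or> V = carrier_vec n"
    proof cases
      case 1
      then have "v = 0\<^sub>v n" if "v \<in> V" for v
        using that F_zero F_inj[of v "0\<^sub>v n"] Vc by (metis image_eqI singletonD subsetD zero_carrier_vec)
      then show ?thesis using V_zero by blast
    next
      case 2
      have "v \<in> V" if "v \<in> carrier_vec n" for v
        using 2 FM[of v] F_inj that Vc by (metis (no_types, lifting) imageE subsetD)
      then show ?thesis using Vc by blast
    qed
  qed
  moreover have "\<rho> h * \<rho> g = \<rho> g * \<rho> h" if "g \<in> carrier C" "h \<in> carrier C" for g h
    using that by (metis C.m_comm \<rho>_mult)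
  ultimately have scalar: "\<exists>c. \<rho> g = c \<cdot>\<^sub>m 1\<^sub>m n" if "g \<in> carrier C" for g
    using split \<rho>_carrier that unfolding splitting_field_def by blast
  define w where "w = b 0"
  have wM: "w \<in> M" using bM n by (simp add: w_def)
  have "w \<noteq> 0" using bB[OF n] B(2) dependent_zero by (auto simp: w_def)
  moreover have "\<exists>c. act g w = c *s w" if g: "g \<in> carrier C" for g
  proof -
    obtain c where c: "\<rho> g = c \<cdot>\<^sub>m 1\<^sub>m n" using scalar[OF g] by blast
    have v: "crd w \<in> carrier_vec n" by (simp add: crd_def)
    have "act g w = F (\<rho> g *\<^sub>v crd w)" using F_act[OF g v] Fcrd[OF wM] by simp
    also have "\<rho> g *\<^sub>v crd w = c \<cdot>\<^sub>v crd w"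
      unfolding c using v by (intro eq_vecI) auto
    also have "F \<dots> = c *s w" using F_smult[OF v] Fcrd[OF wM] by simp
    finally show ?thesis by blast
  qed
  ultimately show thesis using that wM M(3) by blast
qed

section \<open>Characters of finite abelian groups\<close>

lemma carrier_hom_group: "carrier (hom_group H A) = hom H A \<inter> extensional (carrier H)"
  and mult_hom_group: "\<phi> \<otimes>\<^bsub>hom_group H A\<^esub> \<psi> = (\<lambda>x\<in>carrier H. \<phi> x \<otimes>\<^bsub>A\<^esub> \<psi> x)"
  and one_hom_group: "\<one>\<^bsub>hom_group H A\<^esub> = (\<lambda>x\<in>carrier H. \<one>\<^bsub>A\<^esub>)"
  by (simp_all add: hom_group_def)

lemmas hom_group_simps = carrier_hom_group mult_hom_group one_hom_group

lemma comm_group_hom_group: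
  assumes "group H" "comm_group A"
  shows "comm_group (hom_group H A)"
proof -
  interpret H: group H by fact
  interpret A: comm_group A by fact
  note [simp] = hom_group_simps
  have closed: "\<phi> x \<in> carrier A" if "\<phi> \<in> carrier (hom_group H A)" "x \<in> carrier H" for \<phi> x
    using that by (auto simp: hom_def)
  have hom: "\<phi> (x \<otimes>\<^bsub>H\<^esub> y) = \<phi> x \<otimes>\<^bsub>A\<^esub> \<phi> y"
    if "\<phi> \<in> carrier (hom_group H A)" "x \<in> carrier H" "y \<in> carrier H" for \<phi> x y
    using that by (auto simp: hom_def)
  show ?thesis
  proof (rule comm_groupI)
    fix \<phi> \<psi> assume *: "\<phi> \<in> carrier (hom_group H A)" "\<psi> \<in> carrier (hom_group H A)"
    show "\<phi> \<otimes>\<^bsub>hom_group H A\<^esub> \<psi> \<in> carrier (hom_group H A)"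
      using closed[OF *(1)] closed[OF *(2)] hom[OF *(1)] hom[OF *(2)]
      by (auto simp: hom_def A.m_ac)
    show "\<phi> \<otimes>\<^bsub>hom_group H A\<^esub> \<psi> = \<psi> \<otimes>\<^bsub>hom_group H A\<^esub> \<phi>"
      using closed[OF *(1)] closed[OF *(2)] by (auto simp: A.m_comm intro!: restrict_ext)
  next
    show "\<one>\<^bsub>hom_group H A\<^esub> \<in> carrier (hom_group H A)"
      by (auto simp: hom_def)
  next
    fix \<phi> \<psi> \<chi> assume "\<phi> \<in> carrier (hom_group H A)" "\<psi> \<in> carrier (hom_group H A)"
      "\<chi> \<in> carrier (hom_group H A)"
    then show "\<phi> \<otimes>\<^bsub>hom_group H A\<^esub> \<psi> \<otimes>\<^bsub>hom_group H A\<^esub> \<chi> =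
        \<phi> \<otimes>\<^bsub>hom_group H A\<^esub> (\<psi> \<otimes>\<^bsub>hom_group H A\<^esub> \<chi>)"
      using closed by (auto simp: A.m_assoc intro!: restrict_ext)
  next
    fix \<phi> assume \<phi>: "\<phi> \<in> carrier (hom_group H A)"
    show "\<one>\<^bsub>hom_group H A\<^esub> \<otimes>\<^bsub>hom_group H A\<^esub> \<phi> = \<phi>"
      using closed[OF \<phi>] \<phi> by (auto simp: extensional_def fun_eq_iff)
    have "(\<lambda>x\<in>carrier H. inv\<^bsub>A\<^esub> \<phi> x) \<in> carrier (hom_group H A)"
      using closed[OF \<phi>] hom[OF \<phi>] by (auto simp: hom_def A.inv_mult)
    moreover have "(\<lambda>x\<in>carrier H. inv\<^bsub>A\<^esub> \<phi> x) \<otimes>\<^bsub>hom_group H A\<^esub> \<phi> = \<one>\<^bsub>hom_group H A\<^esub>"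
      using closed[OF \<phi>] by (auto simp: fun_eq_iff)
    ultimately show "\<exists>\<psi>\<in>carrier (hom_group H A). \<psi> \<otimes>\<^bsub>hom_group H A\<^esub> \<phi> = \<one>\<^bsub>hom_group H A\<^esub>"
      by blast
  qed
qed

lemma carrier_field_units: "carrier (field_units TYPE('k::field)) = UNIV - {0}"
proof -
  have "\<exists>y. y * x = 1 \<and> x * y = 1" if "x \<noteq> 0" for x :: 'k
    using that by (intro exI[of _ "inverse x"]) auto
  then show ?thesis by (auto simp: units_of_def Units_def)
qed

lemma mult_field_units: "x \<otimes>\<^bsub>field_units TYPE('k::field)\<^esub> y = x * y"
  and one_field_units: "\<one>\<^bsub>field_units TYPE('k)\<^esub> = (1 :: 'k)"
  by (simp_all add: units_of_def)

lemmas field_units_simps = carrier_field_units mult_field_units one_field_units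

lemma comm_group_field_units: "comm_group (field_units TYPE('k::field))"
  by (rule comm_groupI)
    (auto simp: field_units_simps intro!: bexI[of _ "inverse x" for x])

abbreviation characters :: "'k::field itself \<Rightarrow> ('c, 'n) monoid_scheme \<Rightarrow> ('c \<Rightarrow> 'k) set" where
  "characters K C \<equiv> carrier (hom_group C (field_units K))"

lemma character_iff:
  "\<Phi> \<in> characters TYPE('k::field) C \<longleftrightarrow>
    \<Phi> \<in> extensional (carrier C) \<and> (\<forall>x\<in>carrier C. \<Phi> x \<noteq> 0) \<and>
    (\<forall>x\<in>carrier C. \<forall>y\<in>carrier C. \<Phi> (x \<otimes>\<^bsub>C\<^esub> y) = \<Phi> x * \<Phi> y)"
  by (auto simp: hom_group_simps field_units_simps hom_def)

lemma character_one:
  assumes "group C" "\<Phi> \<in> characters TYPE('k::field) C"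
  shows "\<Phi> \<one>\<^bsub>C\<^esub> = 1"
proof -
  interpret group C by fact
  have "\<Phi> \<one>\<^bsub>C\<^esub> * \<Phi> \<one>\<^bsub>C\<^esub> = \<Phi> \<one>\<^bsub>C\<^esub>" "\<Phi> \<one>\<^bsub>C\<^esub> \<noteq> 0"
    using assms(2) unfolding character_iff by (metis one_closed r_one, blast)
  then show ?thesis by simp
qed

lemma character_inv:
  assumes "group C" "\<Phi> \<in> characters TYPE('k::field) C" "x \<in> carrier C"
  shows "\<Phi> (inv\<^bsub>C\<^esub> x) = inverse (\<Phi> x)"
proof -
  interpret group C by fact
  have "\<Phi> (inv\<^bsub>C\<^esub> x) * \<Phi> x = 1"
    using assms character_one[OF assms(1,2)] unfolding character_iff
    by (metis inv_closed l_inv)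
  then show ?thesis by (metis inverse_unique mult.commute)
qed

text \<open>
  The translates of functions on \<open>C\<close> preserve the space of coboundaries
  \<open>f h = u (h c) - u h\<close>, which is nonzero as \<open>c\<close> is not the identity. A common eigenvector \<open>f\<close>
  in it is, up to a constant, a character \<open>\<Phi>\<close>. If \<open>\<Phi> c = 1\<close>, then \<open>f\<close> is constant on the
  powers of \<open>c\<close>, while the sum of its values along the powers telescopes to \<open>0\<close>; in characteristic
  zero this forces \<open>f = 0\<close>.
\<close>

lemma character_separating:
  fixes C :: "('c, 'n) monoid_scheme"
  assumes C: "comm_group C" and fin: "finite (carrier C)"
    and split: "splitting_field TYPE('k::field_char_0) C"
    and c: "c \<in> carrier C" "c \<noteq> \<one>\<^bsub>C\<^esub>"
  obtains \<Phi> where "\<Phi> \<in> characters TYPE('k) C" "\<Phi> c \<noteq> 1"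
proof -
  interpret C: comm_group C by fact
  interpret V: vector_space "\<lambda>(a::'k) (f :: 'c \<Rightarrow> 'k) x. a * f x"
    by unfold_locales (auto simp: fun_eq_iff algebra_simps)
  define cob where "cob u = (\<lambda>h. if h \<in> carrier C then u (h \<otimes>\<^bsub>C\<^esub> c) - u h else 0)" for u :: "'c \<Rightarrow> 'k"
  define act where "act g f = (\<lambda>h. if h \<in> carrier C then f (h \<otimes>\<^bsub>C\<^esub> g) else 0)" for g and f :: "'c \<Rightarrow> 'k"
  define \<delta> where "\<delta> y = (\<lambda>h. if h = y then 1 else 0 :: 'k)" for y :: 'c
  have cob_add: "cob u + cob v = cob (u + v)" for u v by (auto simp: cob_def fun_eq_iff)
  have cob_scale: "(\<lambda>x. a * cob u x) = cob (\<lambda>x. a * u x)" for a u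
    by (auto simp: cob_def fun_eq_iff algebra_simps)
  have act_cob: "act g (cob u) = cob (act g u)" if "g \<in> carrier C" for g u
    using that c(1) by (auto simp: cob_def act_def fun_eq_iff C.m_ac)
  have W: "V.subspace (range cob)"
  proof (rule V.subspaceI)
    have "cob 0 = 0" by (simp add: cob_def fun_eq_iff)
    then show "0 \<in> range cob" by (metis rangeI)
    show "f + g \<in> range cob" if "f \<in> range cob" "g \<in> range cob" for f g
      using that by (auto simp: cob_add)
    show "(\<lambda>x. a * f x) \<in> range cob" if "f \<in> range cob" for a f
      using that by (auto simp: cob_scale)
  qed
  have "cob (\<delta> \<one>\<^bsub>C\<^esub>) \<one>\<^bsub>C\<^esub> = -1" using c by (simp add: cob_def \<delta>_def)
  then have W0: "range cob \<noteq> {0}"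
    by (metis neg_equal_0_iff_equal rangeI singletonD zero_fun_apply zero_neq_one)
  have "cob u \<in> V.span (\<delta> ` carrier C)" for u
  proof -
    have "cob u = (\<Sum>y\<in>carrier C. (\<lambda>x. cob u y * \<delta> y x))"
    proof
      fix x
      have "(\<Sum>y\<in>carrier C. (\<lambda>x. cob u y * \<delta> y x)) x = (\<Sum>y\<in>carrier C. cob u y * \<delta> y x)"
        by (induction rule: infinite_finite_induct) auto
      also have "\<dots> = (\<Sum>y\<in>carrier C. if y = x then cob u x else 0)"
        by (intro sum.cong) (auto simp: \<delta>_def)
      also have "\<dots> = cob u x" using fin by (simp add: cob_def)
      finally show "cob u x = (\<Sum>y\<in>carrier C. (\<lambda>x. cob u y * \<delta> y x)) x" by simp
    qed
    moreover have "\<dots> \<in> V.span (\<delta> ` carrier C)"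
      by (intro V.span_sum V.span_scale V.span_base) auto
    ultimately show ?thesis by simp
  qed
  then have Wspan: "range cob \<subseteq> V.span (\<delta> ` carrier C)" by blast
  obtain f where f: "f \<in> range cob" "f \<noteq> 0"
      and eigen: "\<And>g. g \<in> carrier C \<Longrightarrow> \<exists>a. act g f = (\<lambda>x. a * f x)"
  proof (rule V.splitting_field_common_eigenvector[OF C split W W0 Wspan, of act])
    show "finite (\<delta> ` carrier C)" using fin by simp
    show "act g w \<in> range cob" if "g \<in> carrier C" "w \<in> range cob" for g w
      using that act_cob by auto
    show "act (g \<otimes>\<^bsub>C\<^esub> h) w = act g (act h w)"
      if "g \<in> carrier C" "h \<in> carrier C" for g h w
      using that by (auto simp: act_def fun_eq_iff C.m_assoc)
    show "act \<one>\<^bsub>C\<^esub> w = w" if "w \<in> range cob" for w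
      using that by (auto simp: act_def cob_def fun_eq_iff)
  qed (auto simp: act_def fun_eq_iff)
  obtain u where u: "f = cob u" using f(1) by blast
  have f_outside: "f h = 0" if "h \<notin> carrier C" for h using that by (simp add: u cob_def)
  obtain k where k: "\<And>g h. g \<in> carrier C \<Longrightarrow> h \<in> carrier C \<Longrightarrow> f (h \<otimes>\<^bsub>C\<^esub> g) = k g * f h"
    using eigen unfolding act_def fun_eq_iff by metis
  have f1: "f \<one>\<^bsub>C\<^esub> \<noteq> 0"
  proof
    assume "f \<one>\<^bsub>C\<^esub> = 0"
    then have "f h = 0" for h using k[of h "\<one>\<^bsub>C\<^esub>"] f_outside by (cases "h \<in> carrier C") auto
    then show False using f(2) by (simp add: fun_eq_iff)
  qed
  have k1: "k \<one>\<^bsub>C\<^esub> = 1" using k[of "\<one>\<^bsub>C\<^esub>" "\<one>\<^bsub>C\<^esub>"] f1 by simp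
  have k_mult: "k (x \<otimes>\<^bsub>C\<^esub> y) = k x * k y" if xy: "x \<in> carrier C" "y \<in> carrier C" for x y
  proof -
    have "k (x \<otimes>\<^bsub>C\<^esub> y) * f \<one>\<^bsub>C\<^esub> = f (x \<otimes>\<^bsub>C\<^esub> y)"
      using xy k[of "x \<otimes>\<^bsub>C\<^esub> y" "\<one>\<^bsub>C\<^esub>"] by simp
    also have "\<dots> = k y * (k x * f \<one>\<^bsub>C\<^esub>)" using xy k[of x "\<one>\<^bsub>C\<^esub>"] k[of y x] by simp
    finally show ?thesis using f1 by simp
  qed
  have k_nonzero: "k x \<noteq> 0" if "x \<in> carrier C" for x
    using k_mult[of x "inv\<^bsub>C\<^esub> x"] that k1 by auto
  have "restrict k (carrier C) \<in> characters TYPE('k) C"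
    unfolding character_iff using k_mult k_nonzero by auto
  moreover have "k c \<noteq> 1"
  proof
    assume "k c = 1"
    define m where "m = Coset.order C"
    from \<open>k c = 1\<close> have fc: "f (c [^]\<^bsub>C\<^esub> i) = f \<one>\<^bsub>C\<^esub>" for i :: nat
      using c(1) by (induction i) (auto simp: k)
    have "of_nat m * f \<one>\<^bsub>C\<^esub> = (\<Sum>i<m. f (c [^]\<^bsub>C\<^esub> i))"
      by (simp add: fc)
    also have "\<dots> = (\<Sum>i<m. u (c [^]\<^bsub>C\<^esub> Suc i) - u (c [^]\<^bsub>C\<^esub> i))"
      using c(1) by (simp add: u cob_def)
    also have "\<dots> = u (c [^]\<^bsub>C\<^esub> m) - u (c [^]\<^bsub>C\<^esub> (0::nat))"
      by (rule sum_lessThan_telescope)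
    also have "\<dots> = 0" using C.pow_order_eq_1[OF c(1)] by (simp add: m_def)
    finally have "Coset.order C = 0" using f1 by (simp add: m_def)
    then show False using fin C.order_gt_0_iff_finite by simp
  qed
  ultimately show thesis using that c(1) by (metis restrict_apply')
qed

text \<open>
  The functions \<open>f\<close> such that \<open>a f\<close> is orthogonal to all characters are closed under
  multiplication by \<open>\<chi> - \<chi> s\<close>, because characters are closed under products. Separating characters
  therefore yield such an \<open>f\<close> that vanishes everywhere except at \<open>d\<close>.
\<close>

lemma characters_jointly_faithful:
  assumes C: "comm_group C" and fin: "finite (carrier C)"
    and split: "splitting_field TYPE('k::field_char_0) C"
    and zero: "\<And>\<Phi>. \<Phi> \<in> characters TYPE('k) C \<Longrightarrow> (\<Sum>c\<in>carrier C. a c * \<Phi> c) = 0"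
    and d: "d \<in> carrier C"
  shows "a d = (0 :: 'k)"
proof -
  interpret C: comm_group C by fact
  interpret X: comm_group "hom_group C (field_units TYPE('k))"
    by (rule comm_group_hom_group[OF C.is_group comm_group_field_units])
  have "\<exists>f. (\<forall>\<Psi>\<in>characters TYPE('k) C. (\<Sum>c\<in>carrier C. a c * f c * \<Psi> c) = 0) \<and>
      f d \<noteq> 0 \<and> (\<forall>c\<in>S. f c = 0)"
    if "finite S" "S \<subseteq> carrier C - {d}" for S
    using that
  proof (induction S)
    case empty
    show ?case using zero by (intro exI[of _ "\<lambda>_. 1"]) auto
  next
    case (insert s S)
    then obtain f where f: "\<forall>\<Psi>\<in>characters TYPE('k) C. (\<Sum>c\<in>carrier C. a c * f c * \<Psi> c) = 0"
      "f d \<noteq> 0" "\<forall>c\<in>S. f c = 0" by auto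
    have s: "s \<in> carrier C" "s \<noteq> d" using insert.prems by auto
    have ne: "d \<otimes>\<^bsub>C\<^esub> inv\<^bsub>C\<^esub> s \<noteq> \<one>\<^bsub>C\<^esub>"
    proof
      assume eq: "d \<otimes>\<^bsub>C\<^esub> inv\<^bsub>C\<^esub> s = \<one>\<^bsub>C\<^esub>"
      have "d = d \<otimes>\<^bsub>C\<^esub> inv\<^bsub>C\<^esub> s \<otimes>\<^bsub>C\<^esub> s" using s d by (simp add: C.m_assoc)
      then show False using eq s by simp
    qed
    obtain \<chi> where \<chi>: "\<chi> \<in> characters TYPE('k) C" "\<chi> (d \<otimes>\<^bsub>C\<^esub> inv\<^bsub>C\<^esub> s) \<noteq> 1"
      by (rule character_separating[OF C fin split _ ne]) (use s d in auto)
    have "\<chi> d \<noteq> \<chi> s"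
    proof
      assume "\<chi> d = \<chi> s"
      then have "\<chi> (d \<otimes>\<^bsub>C\<^esub> inv\<^bsub>C\<^esub> s) = \<chi> (s \<otimes>\<^bsub>C\<^esub> inv\<^bsub>C\<^esub> s)"
        using \<chi>(1) s d unfolding character_iff by (metis C.inv_closed)
      then show False using \<chi> s character_one[OF C.is_group \<chi>(1)] by simp
    qed
    moreover have "(\<Sum>c\<in>carrier C. a c * (f c * (\<chi> c - \<chi> s)) * \<Psi> c) = 0"
      if \<Psi>: "\<Psi> \<in> characters TYPE('k) C" for \<Psi>
    proof -
      have "\<chi> \<otimes>\<^bsub>hom_group C (field_units TYPE('k))\<^esub> \<Psi> \<in> characters TYPE('k) C"
        using \<chi>(1) \<Psi> by (rule X.m_closed)
      then have "(\<Sum>c\<in>carrier C. a c * f c * (\<chi> c * \<Psi> c)) = 0"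
        using f(1) by (auto simp: mult_hom_group mult_field_units dest!: bspec)
      moreover have "(\<Sum>c\<in>carrier C. a c * (f c * (\<chi> c - \<chi> s)) * \<Psi> c) =
          (\<Sum>c\<in>carrier C. a c * f c * (\<chi> c * \<Psi> c)) - \<chi> s * (\<Sum>c\<in>carrier C. a c * f c * \<Psi> c)"
        by (simp add: sum_distrib_left algebra_simps flip: sum_subtractf)
      ultimately show ?thesis using f(1) \<Psi> by simp
    qed
    ultimately show ?case
      using f by (intro exI[of _ "\<lambda>c. f c * (\<chi> c - \<chi> s)"]) auto
  qed
  from this[of "carrier C - {d}"] obtain f where
    f: "\<forall>\<Psi>\<in>characters TYPE('k) C. (\<Sum>c\<in>carrier C. a c * f c * \<Psi> c) = 0"
      "f d \<noteq> 0" "\<forall>c\<in>carrier C - {d}. f c = 0"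
    using fin by auto
  define \<Psi> where "\<Psi> = \<one>\<^bsub>hom_group C (field_units TYPE('k))\<^esub>"
  have "0 = (\<Sum>c\<in>carrier C. a c * f c * \<Psi> c)" using f(1) X.one_closed unfolding \<Psi>_def by simp
  also have "\<dots> = (\<Sum>c\<in>carrier C. if c = d then a d * f d else 0)"
    by (intro sum.cong) (auto simp: \<Psi>_def one_hom_group one_field_units f(3))
  also have "\<dots> = a d * f d" using fin d by simp
  finally show ?thesis using f(2) by simp
qed

lemma sum_character:
  assumes C: "comm_group C" and fin: "finite (carrier C)"
    and \<Phi>: "\<Phi> \<in> characters TYPE('k::field) C"
  shows "(\<Sum>c\<in>carrier C. \<Phi> c) = (if \<forall>c\<in>carrier C. \<Phi> c = 1 then of_nat (card (carrier C)) else 0)"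
proof (cases "\<forall>c\<in>carrier C. \<Phi> c = 1")
  case False
  interpret C: comm_group C by fact
  obtain d where d: "d \<in> carrier C" "\<Phi> d \<noteq> 1" using False by blast
  have "\<Phi> d * (\<Sum>c\<in>carrier C. \<Phi> c) = (\<Sum>c\<in>carrier C. \<Phi> (d \<otimes>\<^bsub>C\<^esub> c))"
    using \<Phi> d(1) by (simp add: sum_distrib_left character_iff)
  also have "\<dots> = (\<Sum>c\<in>carrier C. \<Phi> c)"
    using d(1) by (intro sum.reindex_bij_betw)
      (simp add: bij_betw_def C.inj_on_cmult C.surj_const_mult)
  finally have "(\<Sum>c\<in>carrier C. \<Phi> c) = 0" using d(2) by simp
  with False show ?thesis by (simp only: if_False)
qed simp

lemma character_orthogonality:
  assumes C: "comm_group C" and fin: "finite (carrier C)"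
    and \<Phi>: "\<Phi> \<in> characters TYPE('k::field) C" and \<Psi>: "\<Psi> \<in> characters TYPE('k) C"
  shows "(\<Sum>c\<in>carrier C. \<Phi> (inv\<^bsub>C\<^esub> c) * \<Psi> c) =
    (if \<Psi> = \<Phi> then of_nat (card (carrier C)) else 0)"
proof -
  interpret C: comm_group C by fact
  interpret X: comm_group "hom_group C (field_units TYPE('k))"
    by (rule comm_group_hom_group[OF C.is_group comm_group_field_units])
  define \<chi> where "\<chi> = (\<lambda>c\<in>carrier C. \<Phi> (inv\<^bsub>C\<^esub> c) * \<Psi> c)"
  have inv: "\<Phi> (inv\<^bsub>C\<^esub> c) = inverse (\<Phi> c)" if "c \<in> carrier C" for c
    by (rule character_inv[OF C.is_group \<Phi> that])
  have "\<chi> \<in> characters TYPE('k) C"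
    using \<Phi> \<Psi> by (auto simp: character_iff \<chi>_def C.inv_mult algebra_simps)
  from sum_character[OF C fin this]
  have "(\<Sum>c\<in>carrier C. \<Phi> (inv\<^bsub>C\<^esub> c) * \<Psi> c) =
      (if \<forall>c\<in>carrier C. \<chi> c = 1 then of_nat (card (carrier C)) else 0)"
    by (simp add: \<chi>_def cong: sum.cong)
  also have "(\<forall>c\<in>carrier C. \<chi> c = 1) \<longleftrightarrow> \<Psi> = \<Phi>"
  proof -
    have nz: "\<Phi> c \<noteq> 0" if "c \<in> carrier C" for c using \<Phi> that by (simp add: character_iff)
    have "(\<forall>c\<in>carrier C. \<chi> c = 1) \<longleftrightarrow> (\<forall>c\<in>carrier C. \<Psi> c = \<Phi> c)"
      using nz by (auto simp: \<chi>_def inv field_simps)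
    also have "\<dots> \<longleftrightarrow> \<Psi> = \<Phi>"
      using \<Phi> \<Psi> unfolding character_iff by (metis extensionalityI)
    finally show ?thesis .
  qed
  finally show ?thesis .
qed

section \<open>Linear extensions\<close>

lemma lookup_scale [simp]: "Poly_Mapping.lookup (scale c x) b = c * Poly_Mapping.lookup x b"
  by (simp add: scale_def map.rep_eq when_def)

lemma scale_simps:
  "scale 1 x = x" "scale 0 x = 0" "scale c 0 = 0" "scale c (x + y) = scale c x + scale c y"
  "scale (c + d) x = scale c x + scale d x"
  "scale c (scale d x) = scale (c * d) x"
  "scale c (Poly_Mapping.single b d) = Poly_Mapping.single b (c * d)"
  by (rule poly_mapping_eqI; simp add: lookup_add algebra_simps lookup_single when_def)+

lemma scale_sum: "scale c (\<Sum>i\<in>I. f i) = (\<Sum>i\<in>I. scale c (f i))"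
  by (induction I rule: infinite_finite_induct) (simp_all add: scale_simps)

lemma linear_ext_superset:
  assumes "finite S" "Poly_Mapping.keys x \<subseteq> S"
  shows "linear_ext f x = (\<Sum>b\<in>S. scale (Poly_Mapping.lookup x b) (f b))"
  unfolding linear_ext_def using assms
  by (intro sum.mono_neutral_left) (auto simp: in_keys_iff scale_simps)

lemma linear_ext_single [simp]: "linear_ext f (Poly_Mapping.single b c) = scale c (f b)"
  by (subst linear_ext_superset[of "{b}"]) (auto simp: scale_simps)

lemma linear_ext_add: "linear_ext f (x + y) = linear_ext f x + linear_ext f y"
proof -
  let ?S = "Poly_Mapping.keys x \<union> Poly_Mapping.keys y"
  have "finite ?S" "Poly_Mapping.keys (x + y) \<subseteq> ?S"
    using keys_add[of x y] by auto
  then show ?thesis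
    by (simp add: linear_ext_superset[of ?S] lookup_add scale_simps sum.distrib)
qed

lemma linear_ext_scale: "linear_ext f (scale c x) = scale c (linear_ext f x)"
proof -
  have "Poly_Mapping.keys (scale c x) \<subseteq> Poly_Mapping.keys x"
    by (auto simp: in_keys_iff)
  then show ?thesis
    by (simp add: linear_ext_superset[of "Poly_Mapping.keys x"] scale_sum scale_simps)
qed

lemma linear_ext_zero: "linear_ext f 0 = 0"
  by (simp add: linear_ext_def)

lemma linear_ext_sum: "linear_ext f (\<Sum>i\<in>I. x i) = (\<Sum>i\<in>I. linear_ext f (x i))"
  by (induction I rule: infinite_finite_induct) (simp_all add: linear_ext_add linear_ext_zero)

lemma dual_eval_superset:
  assumes "finite S" "Poly_Mapping.keys a \<subseteq> S"
  shows "dual_eval \<Phi> a = (\<Sum>\<phi>\<in>S. Poly_Mapping.lookup a \<phi> * \<Phi> \<phi>)"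
  unfolding dual_eval_def using assms
  by (intro sum.mono_neutral_left) (auto simp: in_keys_iff)

lemma dual_eval_single [simp]: "dual_eval \<Phi> (Poly_Mapping.single \<phi> c) = c * \<Phi> \<phi>"
  by (subst dual_eval_superset[of "{\<phi>}"]) auto

lemma dual_eval_zero [simp]: "dual_eval \<Phi> 0 = 0"
  by (simp add: dual_eval_def)

lemma dual_eval_add: "dual_eval \<Phi> (x + y) = dual_eval \<Phi> x + dual_eval \<Phi> y"
proof -
  let ?S = "Poly_Mapping.keys x \<union> Poly_Mapping.keys y"
  have "finite ?S" "Poly_Mapping.keys (x + y) \<subseteq> ?S"
    using keys_add[of x y] by auto
  then show ?thesis
    by (simp add: dual_eval_superset[of ?S] lookup_add sum.distrib algebra_simps)
qed

lemma dual_eval_scale: "dual_eval \<Phi> (scale c x) = c * dual_eval \<Phi> x"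
proof -
  have "Poly_Mapping.keys (scale c x) \<subseteq> Poly_Mapping.keys x"
    by (auto simp: in_keys_iff)
  then show ?thesis
    by (simp add: dual_eval_superset[of "Poly_Mapping.keys x"] sum_distrib_left mult.assoc)
qed

lemma dual_eval_sum: "dual_eval \<Phi> (\<Sum>i\<in>I. x i) = (\<Sum>i\<in>I. dual_eval \<Phi> (x i))"
  by (induction I rule: infinite_finite_induct) (simp_all add: dual_eval_add)

lemma species_linear:
  "species G q (\<Sum>i\<in>I. scale (c i) (x i)) = (\<Sum>i\<in>I. c i * species G q (x i))"
  by (simp add: species_def split_beta burnside_res_def burnside_proj_def orbit_ext_def
      linear_ext_sum linear_ext_scale dual_eval_sum dual_eval_scale)

lemma species_scale: "species G q (scale c x) = c * species G q x"
  by (simp add: species_def split_beta burnside_res_def burnside_proj_def orbit_ext_def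
      linear_ext_scale dual_eval_scale)

lemma species_add: "species G q (x + y) = species G q x + species G q y"
  by (simp add: species_def split_beta burnside_res_def burnside_proj_def orbit_ext_def
      linear_ext_add dual_eval_add)

lemma species_diff: "species G q (x - y) = species G q x - species G q y"
  using species_add[of G q "x - y" y] by simp

section \<open>Conjugation of subgroups and of homomorphisms\<close>

locale fibered_group = group G + fibre: comm_group A
  for G :: "('g, 'm) monoid_scheme" (structure) and A :: "('a, 'n) monoid_scheme"
begin

abbreviation inner :: "'g \<Rightarrow> 'g \<Rightarrow> 'g" where
  "inner g x \<equiv> inv g \<otimes> x \<otimes> g"

abbreviation dual :: "'g set \<Rightarrow> ('g \<Rightarrow> 'a) set" where
  "dual U \<equiv> carrier (sub_dual G A U)"

lemma inner_mult:
  assumes "g \<in> carrier G" "h \<in> carrier G" "x \<in> carrier G"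
  shows "inner (g \<otimes> h) x = inner h (inner g x)"
  using assms by (simp add: inv_mult_group m_assoc)

lemma inner_hom:
  assumes "g \<in> carrier G" "x \<in> carrier G" "y \<in> carrier G"
  shows "inner g (x \<otimes> y) = inner g x \<otimes> inner g y"
proof -
  have "inner g x \<otimes> inner g y = inv g \<otimes> x \<otimes> (g \<otimes> inv g) \<otimes> y \<otimes> g"
    using assms by (simp add: m_assoc del: r_inv Units_r_inv)
  then show ?thesis using assms by (simp add: m_assoc)
qed

lemma inner_inv_cancel:
  assumes "g \<in> carrier G" "x \<in> carrier G"
  shows "inner g (inner (inv g) x) = x" "inner (inv g) (inner g x) = x"
  using assms inner_mult[of "inv g" g x] inner_mult[of g "inv g" x] by simp_all

lemma inner_inv:
  assumes "g \<in> carrier G" "x \<in> carrier G"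
  shows "inner g (inv x) = inv (inner g x)"
  using assms by (simp add: inv_mult_group m_assoc)

lemma inner_closed: "g \<in> carrier G \<Longrightarrow> x \<in> carrier G \<Longrightarrow> inner g x \<in> carrier G"
  by simp

lemma inj_on_inner: "g \<in> carrier G \<Longrightarrow> inj_on (inner g) (carrier G)"
  by (rule inj_on_inverseI[of _ "inner (inv g)"]) (rule inner_inv_cancel(2))

lemma conj_set_eq:
  assumes "g \<in> carrier G" "U \<subseteq> carrier G"
  shows "conj_set G g U = {x \<in> carrier G. inner g x \<in> U}"
proof -
  have "conj_set G g U = inner (inv g) ` U"
    using assms by (force simp: conj_set_def l_coset_def r_coset_def)
  also have "\<dots> = {x \<in> carrier G. inner g x \<in> U}"
  proof (intro equalityI subsetI)
    fix x assume "x \<in> inner (inv g) ` U"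
    then obtain u where u: "u \<in> U" "x = inner (inv g) u" by blast
    then show "x \<in> {x \<in> carrier G. inner g x \<in> U}"
      using assms inner_inv_cancel(1)[of g u] inner_closed[of "inv g" u] by auto
  next
    fix x assume "x \<in> {x \<in> carrier G. inner g x \<in> U}"
    then show "x \<in> inner (inv g) ` U"
      using assms(1) by (intro image_eqI[of _ _ "inner g x"]) (auto simp only: inner_inv_cancel(2) mem_Collect_eq)
  qed
  finally show ?thesis .
qed

lemma conj_set_carrier: "g \<in> carrier G \<Longrightarrow> conj_set G g (carrier G) = carrier G"
  by (auto simp: conj_set_eq)

lemma conj_set_one: "U \<subseteq> carrier G \<Longrightarrow> conj_set G \<one> U = U"
  by (auto simp: conj_set_eq)

lemma conj_set_subset: "g \<in> carrier G \<Longrightarrow> U \<subseteq> carrier G \<Longrightarrow> conj_set G g U \<subseteq> carrier G"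
  by (auto simp: conj_set_eq)

lemma conj_set_conj_set:
  assumes "g \<in> carrier G" "h \<in> carrier G" "U \<subseteq> carrier G"
  shows "conj_set G g (conj_set G h U) = conj_set G (g \<otimes> h) U"
proof -
  have "conj_set G h U \<subseteq> carrier G" by (rule conj_set_subset) (use assms in auto)
  then show ?thesis
    using assms by (auto simp only: conj_set_eq m_closed inner_mult inner_closed mem_Collect_eq)
qed

lemma inner_image_conj_set:
  assumes "g \<in> carrier G" "U \<subseteq> carrier G"
  shows "inner g ` conj_set G g U = U"
proof
  show "inner g ` conj_set G g U \<subseteq> U" using assms by (auto simp: conj_set_eq)
  show "U \<subseteq> inner g ` conj_set G g U"
  proof
    fix u assume "u \<in> U"
    then have u: "u \<in> carrier G" "u \<in> U" using assms by auto
    have "inner (inv g) u \<in> conj_set G g U"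
      unfolding conj_set_eq[OF assms] mem_Collect_eq inner_inv_cancel(1)[OF assms(1) u(1)]
      using u assms(1) by simp
    then show "u \<in> inner g ` conj_set G g U"
      using inner_inv_cancel(1)[OF assms(1) u(1)] by (metis image_eqI)
  qed
qed

lemma card_conj_set:
  assumes "g \<in> carrier G" "U \<subseteq> carrier G"
  shows "card (conj_set G g U) = card U"
proof -
  have "inj_on (inner g) (conj_set G g U)"
    using inj_on_inner[OF assms(1)] conj_set_subset[OF assms] by (rule inj_on_subset)
  then have "card (inner g ` conj_set G g U) = card (conj_set G g U)" by (rule card_image)
  then show ?thesis unfolding inner_image_conj_set[OF assms] by (rule sym)
qed

lemma subgroup_conj_set:
  assumes "g \<in> carrier G" "subgroup U G"
  shows "subgroup (conj_set G g U) G"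
proof -
  interpret U: subgroup U G by fact
  show ?thesis
  proof (rule subgroup.intro)
    show "conj_set G g U \<subseteq> carrier G" by (rule conj_set_subset[OF assms(1) U.subset])
    show "x \<otimes> y \<in> conj_set G g U" if "x \<in> conj_set G g U" "y \<in> conj_set G g U" for x y
      using that assms(1) by (simp add: conj_set_eq[OF _ U.subset] inner_hom)
    show "\<one> \<in> conj_set G g U" using assms(1) by (simp add: conj_set_eq[OF _ U.subset])
    show "inv x \<in> conj_set G g U" if "x \<in> conj_set G g U" for x
      using that assms(1) by (simp add: conj_set_eq[OF _ U.subset] inner_inv)
  qed
qed

lemma dual_iff:
  "\<phi> \<in> dual U \<longleftrightarrow> \<phi> \<in> extensional U \<and> (\<forall>x\<in>U. \<phi> x \<in> carrier A) \<and>
    (\<forall>x\<in>U. \<forall>y\<in>U. \<phi> (x \<otimes> y) = \<phi> x \<otimes>\<^bsub>A\<^esub> \<phi> y)"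
  by (auto simp: hom_group_simps hom_def)

lemma dual_one:
  assumes "subgroup U G" "\<phi> \<in> dual U"
  shows "\<phi> \<one> = \<one>\<^bsub>A\<^esub>"
proof -
  interpret U: subgroup U G by fact
  have "\<phi> \<one> \<otimes>\<^bsub>A\<^esub> \<phi> \<one> = \<phi> \<one>" "\<phi> \<one> \<in> carrier A"
    using assms(2) U.one_closed unfolding dual_iff by (metis one_closed r_one, blast)
  then show ?thesis by (metis fibre.l_cancel_one)
qed

text \<open>
  As \<open>A\<close> is abelian, the values at \<open>u\<close> and at its inverse cancel.
\<close>

lemma dual_conj_invariant:
  assumes U: "subgroup U G" and \<phi>: "\<phi> \<in> dual U" and "x \<in> U" "u \<in> U"
  shows "\<phi> (inner u x) = \<phi> x"
proof -
  interpret U: subgroup U G by fact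
  note dual = \<phi>[unfolded dual_iff]
  have iu: "inv u \<in> U" using assms by simp
  have "\<phi> (inner u x) = \<phi> (inv u) \<otimes>\<^bsub>A\<^esub> \<phi> x \<otimes>\<^bsub>A\<^esub> \<phi> u"
    using dual assms(3,4) iu by simp
  also have "\<dots> = (\<phi> (inv u) \<otimes>\<^bsub>A\<^esub> \<phi> u) \<otimes>\<^bsub>A\<^esub> \<phi> x"
    using dual assms(3,4) iu by (simp add: fibre.m_ac)
  also have "\<phi> (inv u) \<otimes>\<^bsub>A\<^esub> \<phi> u = \<phi> (inv u \<otimes> u)"
    using dual iu assms(4) by (metis (no_types))
  also have "\<dots> = \<one>\<^bsub>A\<^esub>" using assms(4) U.subset dual_one[OF U \<phi>] by auto
  finally show ?thesis using dual assms(3) by simp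
qed

text \<open>
  \<open>conj_into g L U\<close> expresses \<open>L \<subseteq> g U g\<^sup>-\<^sup>1\<close> and \<open>conj_res g L \<phi>\<close> is then the restriction of
  the conjugate of \<open>\<phi>\<close> to \<open>L\<close>. The pointwise form reduces the
  laws of composition to the one of \<open>inner\<close>.
\<close>

definition conj_into :: "'g \<Rightarrow> 'g set \<Rightarrow> 'g set \<Rightarrow> bool" where
  "conj_into g L U \<longleftrightarrow> (\<forall>x\<in>L. inner g x \<in> U)"

definition conj_res :: "'g \<Rightarrow> 'g set \<Rightarrow> ('g \<Rightarrow> 'a) \<Rightarrow> 'g \<Rightarrow> 'a" where
  "conj_res g L \<phi> = (\<lambda>x\<in>L. \<phi> (inner g x))"

lemma conj_into_iff:
  "g \<in> carrier G \<Longrightarrow> U \<subseteq> carrier G \<Longrightarrow> L \<subseteq> carrier G \<Longrightarrow> conj_into g L U \<longleftrightarrow> L \<subseteq> conj_set G g U"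
  by (auto simp: conj_into_def conj_set_eq)

lemma conj_res_in_dual:
  assumes "g \<in> carrier G" "subgroup L G" "\<phi> \<in> dual U" "conj_into g L U"
  shows "conj_res g L \<phi> \<in> dual L"
proof -
  interpret L: subgroup L G by fact
  show ?thesis
    using assms(1,3,4) unfolding dual_iff conj_res_def conj_into_def
    by (auto simp: inner_hom)
qed

lemma conj_hom_eq: "conj_hom G g U \<phi> = conj_res g (conj_set G g U) \<phi>"
  by (simp add: conj_hom_def conj_res_def)

lemma conj_into_conj_set: "g \<in> carrier G \<Longrightarrow> U \<subseteq> carrier G \<Longrightarrow> conj_into g (conj_set G g U) U"
  by (auto simp: conj_into_def conj_set_eq)

lemma conj_hom_in_dual:
  assumes "g \<in> carrier G" "subgroup U G" "\<phi> \<in> dual U"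
  shows "conj_hom G g U \<phi> \<in> dual (conj_set G g U)"
  unfolding conj_hom_eq
  using assms by (intro conj_res_in_dual[of _ _ _ U] subgroup_conj_set conj_into_conj_set)
    (auto dest: subgroup.subset)

lemma conj_res_conj_hom:
  assumes "g \<in> carrier G" "h \<in> carrier G" "U \<subseteq> carrier G" "L \<subseteq> carrier G"
    "conj_into g L (conj_set G h U)"
  shows "conj_res g L (conj_hom G h U \<phi>) = conj_res (g \<otimes> h) L \<phi>"
  using assms unfolding conj_res_def conj_hom_def conj_into_def
  by (intro restrict_ext) (simp only: restrict_apply' inner_mult subsetD)

lemma conj_into_conj:
  assumes "g \<in> carrier G" "h \<in> carrier G" "U \<subseteq> carrier G" "L \<subseteq> carrier G"
  shows "conj_into g L (conj_set G h U) \<longleftrightarrow> conj_into (g \<otimes> h) L U"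
  using assms by (simp add: conj_into_iff conj_set_conj_set conj_set_subset)

lemma mpairs_iff: "(U, \<phi>) \<in> mpairs G A \<longleftrightarrow> subgroup U G \<and> \<phi> \<in> dual U"
  by (simp add: mpairs_def)

lemma mconj_eq: "mconj G g (U, \<phi>) = (conj_set G g U, conj_hom G g U \<phi>)"
  by (simp add: mconj_def)

lemma mconj_mconj:
  assumes "g \<in> carrier G" "h \<in> carrier G" "p \<in> mpairs G A"
  shows "mconj G g (mconj G h p) = mconj G (g \<otimes> h) p"
proof (cases p)
  case (Pair U \<phi>)
  then have U: "U \<subseteq> carrier G" using assms(3) by (auto simp: mpairs_iff dest: subgroup.subset)
  note sub = conj_set_subset[OF assms(2) U]
  show ?thesis
    using assms(1,2) U sub
    by (simp add: Pair mconj_eq conj_set_conj_set conj_hom_eq[of g] conj_hom_eq[of "g \<otimes> h"]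
        conj_res_conj_hom conj_into_iff conj_set_subset)
qed

lemma mconj_one:
  assumes "p \<in> mpairs G A"
  shows "mconj G \<one> p = p"
proof (cases p)
  case (Pair U \<phi>)
  interpret U: subgroup U G using assms by (simp add: Pair mpairs_iff)
  have "\<phi> \<in> extensional U" using assms by (simp add: Pair mpairs_iff dual_iff)
  then have "conj_hom G \<one> U \<phi> = \<phi>"
    by (intro extensionalityI[of _ U])
      (auto simp: conj_hom_def conj_set_one[OF U.subset] U.mem_carrier)
  then show ?thesis by (simp add: Pair mconj_eq conj_set_one[OF U.subset])
qed

lemma self_in_orbit: "p \<in> mpairs G A \<Longrightarrow> p \<in> orbit G (mconj G) p"
  unfolding orbit_def by (metis (mono_tags, lifting) mconj_one mem_Collect_eq one_closed)

lemma orbit_eq: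
  assumes p: "p \<in> mpairs G A" and q: "q \<in> orbit G (mconj G) p"
  shows "orbit G (mconj G) q = orbit G (mconj G) p"
proof -
  obtain h where h: "h \<in> carrier G" "q = mconj G h p" using q by (auto simp: orbit_def)
  show ?thesis
  proof (intro equalityI subsetI)
    fix r assume "r \<in> orbit G (mconj G) q"
    then obtain g where "g \<in> carrier G" "r = mconj G g q" by (auto simp: orbit_def)
    then have "r = mconj G (g \<otimes> h) p" "g \<otimes> h \<in> carrier G"
      using h p by (simp_all add: mconj_mconj)
    then show "r \<in> orbit G (mconj G) p" by (auto simp: orbit_def)
  next
    fix r assume "r \<in> orbit G (mconj G) p"
    then obtain g where g: "g \<in> carrier G" "r = mconj G g p" by (auto simp: orbit_def)
    have "mconj G (g \<otimes> inv h) q = mconj G (g \<otimes> inv h \<otimes> h) p"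
      using h g(1) p by (simp add: mconj_mconj)
    also have "g \<otimes> inv h \<otimes> h = g" using h g by (simp add: m_assoc)
    finally have "r = mconj G (g \<otimes> inv h) q" using g(2) by simp
    then show "r \<in> orbit G (mconj G) q"
      using g(1) h(1) unfolding orbit_def by blast
  qed
qed

lemma some_in_orbit:
  assumes "p \<in> mpairs G A"
  obtains g where "g \<in> carrier G" "(SOME q. q \<in> orbit G (mconj G) p) = mconj G g p"
proof -
  have "(SOME q. q \<in> orbit G (mconj G) p) \<in> orbit G (mconj G) p"
    by (rule someI[of "\<lambda>q. q \<in> orbit G (mconj G) p", OF self_in_orbit[OF assms]])
  then show thesis using that by (auto simp: orbit_def)
qed

text \<open>
  The projection is evaluated at a chosen representative of the orbit. The choice does not matter
  here: conjugation fixes a pair whose first component is the whole group and never turns another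
  pair into such a one.
\<close>

lemma burnside_proj_orbit_elem:
  assumes V: "subgroup V G" and \<psi>: "\<psi> \<in> dual V"
  shows "burnside_proj (carrier G) (orbit_elem G V \<psi> :: ('g, 'a, 'k::field) burnside) =
    (if V = carrier G then Poly_Mapping.single \<psi> 1 else 0)"
proof -
  have p: "(V, \<psi>) \<in> mpairs G A" using assms by (simp add: mpairs_iff)
  obtain g where g: "g \<in> carrier G"
      "(SOME q. q \<in> orbit G (mconj G) (V, \<psi>)) = mconj G g (V, \<psi>)"
    by (rule some_in_orbit[OF p])
  have Vsub: "V \<subseteq> carrier G" using V by (rule subgroup.subset)
  have "conj_set G g V = carrier G \<longleftrightarrow> V = carrier G"
    using inner_image_conj_set[OF g(1) Vsub] inner_image_conj_set[OF g(1) subset_refl]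
      conj_set_carrier[OF g(1)] by metis
  moreover have "conj_hom G g V \<psi> = \<psi>" if "V = carrier G"
  proof (rule extensionalityI[of _ "carrier G"])
    show "\<psi> \<in> extensional (carrier G)" using \<psi> that unfolding dual_iff by blast
    show "conj_hom G g V \<psi> x = \<psi> x" if "x \<in> carrier G" for x
      using dual_conj_invariant[OF V \<psi>, of x g] that \<open>V = carrier G\<close> g(1)
      by (simp add: conj_hom_def conj_set_carrier)
  qed (simp add: conj_hom_def that conj_set_carrier[OF g(1)])
  ultimately show ?thesis
    by (auto simp: burnside_proj_def orbit_ext_def orbit_elem_def g(2) mconj_eq scale_simps)
qed

section \<open>Double cosets and the species of basis elements\<close>

lemma double_coset_mem:
  assumes "subgroup H G" "subgroup U G" "g \<in> carrier G"
  shows "x \<in> H <#> (g <# U) \<longleftrightarrow> (\<exists>h\<in>H. \<exists>u\<in>U. x = h \<otimes> g \<otimes> u)"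
proof -
  have "H \<subseteq> carrier G" "U \<subseteq> carrier G" using assms by (auto dest: subgroup.subset)
  then have "h \<otimes> (g \<otimes> u) = h \<otimes> g \<otimes> u" if "h \<in> H" "u \<in> U" for h u
    using that assms(3) by (simp add: m_assoc subset_iff)
  then show ?thesis by (force simp: set_mult_def l_coset_def)
qed

lemma double_coset_subset:
  assumes "subgroup H G" "subgroup U G" "g \<in> carrier G"
  shows "H <#> (g <# U) \<subseteq> carrier G"
  using assms by (auto simp: double_coset_mem intro!: m_closed dest: subgroup.mem_carrier)

lemma self_in_double_coset:
  assumes "subgroup H G" "subgroup U G" "g \<in> carrier G"
  shows "g \<in> H <#> (g <# U)"
proof -
  have "\<one> \<in> H" "\<one> \<in> U" "g = \<one> \<otimes> g \<otimes> \<one>"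
    using assms by (auto simp: subgroup.one_closed)
  then show ?thesis unfolding double_coset_mem[OF assms] by blast
qed

lemma double_coset_eq:
  assumes H: "subgroup H G" and U: "subgroup U G" and g: "g \<in> carrier G"
    and x: "x \<in> H <#> (g <# U)"
  shows "H <#> (x <# U) = H <#> (g <# U)"
proof -
  interpret H: subgroup H G by fact
  interpret U: subgroup U G by fact
  have sub: "H <#> (y <# U) \<subseteq> H <#> (z <# U)"
    if z: "z \<in> carrier G" and y: "y \<in> H <#> (z <# U)" for y z
  proof
    fix w assume w: "w \<in> H <#> (y <# U)"
    have y': "y \<in> carrier G" using y double_coset_subset[OF H U z] by blast
    obtain h u where hu: "h \<in> H" "u \<in> U" "y = h \<otimes> z \<otimes> u"
      using y double_coset_mem[OF H U z] by blast
    obtain h' u' where hu': "h' \<in> H" "u' \<in> U" "w = h' \<otimes> y \<otimes> u'"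
      using w double_coset_mem[OF H U y'] by blast
    have "w = (h' \<otimes> h) \<otimes> z \<otimes> (u \<otimes> u')" "h' \<otimes> h \<in> H" "u \<otimes> u' \<in> U"
      using hu hu' z by (simp_all add: m_assoc)
    then show "w \<in> H <#> (z <# U)" using double_coset_mem[OF H U z] by blast
  qed
  have x': "x \<in> carrier G" using x double_coset_subset[OF H U g] by blast
  obtain h u where hu: "h \<in> H" "u \<in> U" "x = h \<otimes> g \<otimes> u"
    using x double_coset_mem[OF H U g] by blast
  have "inv h \<otimes> x \<otimes> inv u = (inv h \<otimes> h) \<otimes> g \<otimes> (u \<otimes> inv u)"
    using hu g by (simp add: m_assoc del: l_inv r_inv Units_l_inv Units_r_inv)
  then have "g = inv h \<otimes> x \<otimes> inv u" "inv h \<in> H" "inv u \<in> U" using hu g by simp_all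
  then have "g \<in> H <#> (x <# U)" using double_coset_mem[OF H U x'] by blast
  then show ?thesis using sub[OF g x] sub[OF x'] by blast
qed

text \<open>
  Exactly these double cosets contribute to a species; being single left cosets, they all have
  \<open>card U\<close> elements, which turns a sum over double cosets into a sum over the group.
\<close>

lemma double_coset_conj_into:
  assumes H: "subgroup H G" and U: "subgroup U G" and g: "g \<in> carrier G"
    and into: "conj_into g H U"
  shows "H <#> (g <# U) = g <# U"
proof
  interpret H: subgroup H G by fact
  interpret U: subgroup U G by fact
  show "H <#> (g <# U) \<subseteq> g <# U"
  proof
    fix x assume "x \<in> H <#> (g <# U)"
    then obtain h u where hu: "h \<in> H" "u \<in> U" "x = h \<otimes> g \<otimes> u"
      using double_coset_mem[OF H U g] by blast
    have "g \<otimes> (inner g h \<otimes> u) = g \<otimes> inv g \<otimes> h \<otimes> g \<otimes> u"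
      using hu g by (simp add: m_assoc del: r_inv Units_r_inv)
    then have "x = g \<otimes> (inner g h \<otimes> u)" using hu g by simp
    moreover have "inner g h \<otimes> u \<in> U" using hu into by (auto simp: conj_into_def)
    ultimately show "x \<in> g <# U" by (auto simp: l_coset_def)
  qed
  show "g <# U \<subseteq> H <#> (g <# U)"
  proof
    fix x assume "x \<in> g <# U"
    then obtain u where "u \<in> U" "x = \<one> \<otimes> g \<otimes> u" using g by (auto simp: l_coset_def)
    then show "x \<in> H <#> (g <# U)" using double_coset_mem[OF H U g] H.one_closed by blast
  qed
qed

lemma double_cosets_eq_image: "double_cosets G H U = (\<lambda>g. H <#> (g <# U)) ` carrier G"
  by (auto simp: double_cosets_def)

lemma some_in_double_coset:
  assumes H: "subgroup H G" and U: "subgroup U G" and D: "D \<in> double_cosets G H U"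
  shows "(SOME g. g \<in> D) \<in> D" "(SOME g. g \<in> D) \<in> carrier G"
    "D = H <#> ((SOME g. g \<in> D) <# U)"
proof -
  obtain g where g: "g \<in> carrier G" "D = H <#> (g <# U)"
    using D by (auto simp: double_cosets_eq_image)
  have "g \<in> D" using self_in_double_coset[OF H U g(1)] g(2) by simp
  then show r: "(SOME g. g \<in> D) \<in> D" by (rule someI)
  then show "(SOME g. g \<in> D) \<in> carrier G" using double_coset_subset[OF H U g(1)] g(2) by blast
  show "D = H <#> ((SOME g. g \<in> D) <# U)" using double_coset_eq[OF H U g(1)] r g(2) by simp
qed

lemma double_coset_reps_subset:
  "subgroup H G \<Longrightarrow> subgroup U G \<Longrightarrow> double_coset_reps G H U \<subseteq> carrier G"
  unfolding double_coset_reps_def by (auto intro: some_in_double_coset)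

lemma sum_double_coset_reps:
  fixes F :: "'g \<Rightarrow> 'k::field_char_0"
  assumes fin: "finite (carrier G)" and H: "subgroup H G" and U: "subgroup U G"
    and const: "\<And>h g u. h \<in> H \<Longrightarrow> g \<in> carrier G \<Longrightarrow> u \<in> U \<Longrightarrow> F (h \<otimes> g \<otimes> u) = F g"
    and supp: "\<And>g. g \<in> carrier G \<Longrightarrow> F g \<noteq> 0 \<Longrightarrow> conj_into g H U"
  shows "(\<Sum>g\<in>carrier G. F g) = of_nat (card U) * (\<Sum>g\<in>double_coset_reps G H U. F g)"
proof -
  define rep where "rep D = (SOME g. g \<in> D)" for D :: "'g set"
  define dc where "dc g = H <#> (g <# U)" for g
  note some = some_in_double_coset[OF H U, folded rep_def dc_def]
  have "finite (double_cosets G H U)" using fin by (simp add: double_cosets_eq_image)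
  then have "(\<Sum>g\<in>carrier G. F g) =
      (\<Sum>D\<in>double_cosets G H U. \<Sum>g\<in>{g \<in> carrier G. dc g = D}. F g)"
    using fin by (intro sum.group[symmetric]) (auto simp: double_cosets_eq_image dc_def)
  also have "\<dots> = (\<Sum>D\<in>double_cosets G H U. of_nat (card U) * F (rep D))"
  proof (rule sum.cong)
    fix D assume D: "D \<in> double_cosets G H U"
    note r = some[OF D]
    have "{g \<in> carrier G. dc g = D} = D"
    proof (intro equalityI subsetI)
      fix g assume "g \<in> {g \<in> carrier G. dc g = D}"
      then show "g \<in> D" using self_in_double_coset[OF H U] by (auto simp: dc_def)
    next
      fix g assume "g \<in> D"
      then have "g \<in> dc (rep D)" using r(3) by simp
      then have "dc g = dc (rep D)" "g \<in> carrier G"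
        using double_coset_eq[OF H U r(2)] double_coset_subset[OF H U r(2)]
        by (auto simp: dc_def)
      then show "g \<in> {g \<in> carrier G. dc g = D}" using r(3) by simp
    qed
    moreover have "F g = F (rep D)" if "g \<in> D" for g
    proof -
      have "g \<in> dc (rep D)" using r(3) that by simp
      then show ?thesis
        using const r(2) double_coset_mem[OF H U r(2)] by (auto simp: dc_def)
    qed
    moreover have "card D = card U" if "F (rep D) \<noteq> 0"
    proof -
      have "D = rep D <# U"
        using r(3) double_coset_conj_into[OF H U r(2) supp[OF r(2) that]] by (simp add: dc_def)
      also have "\<dots> = (\<lambda>u. rep D \<otimes> u) ` U" by (auto simp: l_coset_def)
      finally show ?thesis
        using card_image[OF inj_on_subset[OF inj_on_cmult[OF r(2)] subgroup.subset[OF U]]] by simp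
    qed
    ultimately show "(\<Sum>g\<in>{g \<in> carrier G. dc g = D}. F g) = of_nat (card U) * F (rep D)"
      by (cases "F (rep D) = 0") simp_all
  qed simp
  also have "\<dots> = of_nat (card U) * (\<Sum>D\<in>double_cosets G H U. F (rep D))"
    by (simp add: sum_distrib_left)
  also have "(\<Sum>D\<in>double_cosets G H U. F (rep D)) = (\<Sum>g\<in>double_coset_reps G H U. F g)"
  proof -
    have "inj_on rep (double_cosets G H U)" using some(3) by (metis inj_onI)
    then show ?thesis
      by (simp add: double_coset_reps_def sum.reindex rep_def[symmetric] flip: rep_def)
  qed
  finally show ?thesis .
qed

lemma conj_res_double_coset:
  assumes H: "subgroup H G" and U: "subgroup U G" and g: "g \<in> carrier G"
    and \<phi>: "\<phi> \<in> dual U" and h: "h \<in> H" and u: "u \<in> U"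
  shows "conj_into (h \<otimes> g \<otimes> u) H U \<longleftrightarrow> conj_into g H U"
    and "conj_into g H U \<Longrightarrow> conj_res (h \<otimes> g \<otimes> u) H \<phi> = conj_res g H \<phi>"
proof -
  interpret H: subgroup H G by fact
  interpret U: subgroup U G by fact
  have hc: "h \<in> carrier G" and uc: "u \<in> carrier G" using h u by auto
  have split: "inner (h \<otimes> g \<otimes> u) x = inner u (inner g (inner h x))" if "x \<in> carrier G" for x
    using that hc uc g by (simp only: inner_mult inner_closed m_closed)
  have closed: "inner h x \<in> H" if "x \<in> H" for x using that h by simp
  have into: "conj_into (h' \<otimes> k \<otimes> u') H U"
    if "conj_into k H U" "h' \<in> H" "k \<in> carrier G" "u' \<in> U" for h' k u'
  proof -
    have "inner (h' \<otimes> k \<otimes> u') x = inner u' (inner k (inner h' x))" if "x \<in> H" for x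
      using that \<open>h' \<in> H\<close> \<open>k \<in> carrier G\<close> \<open>u' \<in> U\<close>
      by (simp only: inner_mult inner_closed m_closed H.mem_carrier U.mem_carrier)
    moreover have "inner u' (inner k (inner h' x)) \<in> U" if "x \<in> H" for x
    proof -
      have "inner h' x \<in> H" using that \<open>h' \<in> H\<close> by simp
      then have "inner k (inner h' x) \<in> U" using \<open>conj_into k H U\<close> unfolding conj_into_def by blast
      with \<open>u' \<in> U\<close> show ?thesis by (simp only: U.m_closed U.m_inv_closed)
    qed
    ultimately show ?thesis unfolding conj_into_def by simp
  qed
  show iff: "conj_into (h \<otimes> g \<otimes> u) H U \<longleftrightarrow> conj_into g H U"
  proof
    assume hgu: "conj_into (h \<otimes> g \<otimes> u) H U"
    have "conj_into (inv h \<otimes> (h \<otimes> g \<otimes> u) \<otimes> inv u) H U"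
      by (rule into[OF hgu]) (use h u g hc uc in auto)
    moreover have "inv h \<otimes> (h \<otimes> g \<otimes> u) \<otimes> inv u = (inv h \<otimes> h) \<otimes> g \<otimes> (u \<otimes> inv u)"
      using hc uc g by (simp add: m_assoc del: l_inv r_inv Units_l_inv Units_r_inv)
    ultimately show "conj_into g H U" using hc uc g by simp
  qed (use into h u g in blast)
  assume gi: "conj_into g H U"
  have "\<phi> (inner u (inner g (inner h x))) = \<phi> (inner g x)" if x: "x \<in> H" for x
  proof -
    have gx: "inner g x \<in> U" and gh: "inner g h \<in> U" and ghx: "inner g (inner h x) \<in> U"
      using gi x h closed[OF x] unfolding conj_into_def by blast+
    have "\<phi> (inner u (inner g (inner h x))) = \<phi> (inner g (inner h x))"
      by (rule dual_conj_invariant[OF U \<phi> ghx u])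
    also have "\<phi> (inner g (inner h x)) = \<phi> (inner g x)"
    proof -
      have "inner g (inner h x) = inner g (inv h) \<otimes> inner g x \<otimes> inner g h"
        using hc x g by (simp only: inner_hom inner_closed m_closed inv_closed H.mem_carrier)
      also have "\<dots> = inner (inner g h) (inner g x)" unfolding inner_inv[OF g hc] ..
      finally show ?thesis using dual_conj_invariant[OF U \<phi> gx gh] by simp
    qed
    finally show ?thesis .
  qed
  then show "conj_res (h \<otimes> g \<otimes> u) H \<phi> = conj_res g H \<phi>"
    unfolding conj_res_def by (intro restrict_ext) (simp only: split H.mem_carrier)
qed

lemma fibered_group_subgroup: "subgroup H G \<Longrightarrow> fibered_group (G\<lparr>carrier := H\<rparr>) A"
  by (simp add: fibered_group_def subgroup_imp_group fibre.comm_group_axioms)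

text \<open>
  The double coset formula for the restriction keeps, after the projection, only those \<open>g\<close> with
  \<open>H \<subseteq> g U g\<^sup>-\<^sup>1\<close>. Summing over all of \<open>G\<close> instead of choosing representatives makes the value
  visibly independent of the representatives of the double cosets and of the orbit.
\<close>

lemma species_orbit_elem:
  fixes \<Phi> :: "('g \<Rightarrow> 'a) \<Rightarrow> 'k::field_char_0"
  assumes fin: "finite (carrier G)" and H: "subgroup H G" and U: "subgroup U G" and \<phi>: "\<phi> \<in> dual U"
  shows "species G (H, \<Phi>) (orbit_elem G U \<phi>) =
    (\<Sum>g | g \<in> carrier G \<and> conj_into g H U. \<Phi> (conj_res g H \<phi>)) / of_nat (card U)"
proof -
  interpret GH: fibered_group "G\<lparr>carrier := H\<rparr>" A by (rule fibered_group_subgroup[OF H])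
  interpret H: subgroup H G by fact
  define F where "F W \<chi> g = (if conj_into g H W then \<Phi> (conj_res g H \<chi>) else 0)" for W \<chi> g
  have p: "(U, \<phi>) \<in> mpairs G A" using U \<phi> by (simp add: mpairs_iff)
  obtain k where k: "k \<in> carrier G"
      "(SOME q. q \<in> orbit G (mconj G) (U, \<phi>)) = mconj G k (U, \<phi>)"
    by (rule some_in_orbit[OF p])
  define V where "V = conj_set G k U"
  define \<psi> where "\<psi> = conj_hom G k U \<phi>"
  have V: "subgroup V G" and \<psi>: "\<psi> \<in> dual V"
    using k(1) U \<phi> by (auto simp: V_def \<psi>_def subgroup_conj_set conj_hom_in_dual)
  have Usub: "U \<subseteq> carrier G" and Vsub: "V \<subseteq> carrier G" using U V by (auto dest: subgroup.subset)
  have finV: "finite V" using Vsub fin finite_subset by blast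
  have cardV: "card V = card U" unfolding V_def by (rule card_conj_set[OF k(1) Usub])
  have "V \<noteq> {}" using subgroup.one_closed[OF V] by blast
  then have "card V \<noteq> 0" using finV by simp
  have proj: "burnside_proj H (orbit_elem (G\<lparr>carrier := H\<rparr>) (H \<inter> conj_set G g V)
        (restrict (conj_hom G g V \<psi>) (H \<inter> conj_set G g V)) :: ('g, 'a, 'k) burnside) =
      (if conj_into g H V then Poly_Mapping.single (conj_res g H \<psi>) 1 else 0)"
    if g: "g \<in> carrier G" for g
  proof -
    let ?W = "H \<inter> conj_set G g V"
    have W: "subgroup ?W G" using H subgroup_conj_set[OF g V] by (rule subgroups_Inter_pair)
    have "subgroup ?W (G\<lparr>carrier := H\<rparr>)" by (rule subgroup_incl[OF W H]) simp
    moreover have res: "restrict (conj_hom G g V \<psi>) ?W = conj_res g ?W \<psi>"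
      by (auto simp: conj_hom_def conj_res_def)
    moreover have "conj_res g ?W \<psi> \<in> dual ?W"
      by (rule conj_res_in_dual[OF g W \<psi>]) (auto simp: conj_into_def conj_set_eq[OF g Vsub])
    ultimately have "burnside_proj H (orbit_elem (G\<lparr>carrier := H\<rparr>) ?W (restrict (conj_hom G g V \<psi>) ?W) :: ('g, 'a, 'k) burnside) =
        (if ?W = H then Poly_Mapping.single (conj_res g ?W \<psi>) 1 else 0)"
      using GH.burnside_proj_orbit_elem[of ?W "conj_res g ?W \<psi>"] by simp
    moreover have "?W = H \<longleftrightarrow> conj_into g H V"
      using conj_into_iff[OF g Vsub H.subset] by blast
    ultimately show ?thesis by auto
  qed
  have "species G (H, \<Phi>) (orbit_elem G U \<phi>) = dual_eval \<Phi> (burnside_proj H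
      (\<Sum>g\<in>double_coset_reps G H V. orbit_elem (G\<lparr>carrier := H\<rparr>) (H \<inter> conj_set G g V)
        (restrict (conj_hom G g V \<psi>) (H \<inter> conj_set G g V))))"
    by (simp add: species_def burnside_res_def orbit_ext_def orbit_elem_def[of G U] scale_simps
        k(2) mconj_eq V_def \<psi>_def)
  also have "\<dots> = (\<Sum>g\<in>double_coset_reps G H V. dual_eval \<Phi> (burnside_proj H
      (orbit_elem (G\<lparr>carrier := H\<rparr>) (H \<inter> conj_set G g V)
        (restrict (conj_hom G g V \<psi>) (H \<inter> conj_set G g V)))))"
    by (simp add: burnside_proj_def orbit_ext_def linear_ext_sum dual_eval_sum)
  also have "\<dots> = (\<Sum>g\<in>double_coset_reps G H V. F V \<psi> g)"
    using double_coset_reps_subset[OF H V] by (intro sum.cong) (auto simp: proj F_def)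
  also have "\<dots> = (\<Sum>g\<in>carrier G. F V \<psi> g) / of_nat (card V)"
  proof -
    have "(\<Sum>g\<in>carrier G. F V \<psi> g) = of_nat (card V) * (\<Sum>g\<in>double_coset_reps G H V. F V \<psi> g)"
    proof (rule sum_double_coset_reps[OF fin H V])
      fix h g u assume "h \<in> H" "g \<in> carrier G" "u \<in> V"
      then show "F V \<psi> (h \<otimes> g \<otimes> u) = F V \<psi> g"
        using conj_res_double_coset[OF H V _ \<psi>] by (simp add: F_def)
    next
      fix g assume "F V \<psi> g \<noteq> 0"
      then show "conj_into g H V" by (metis F_def)
    qed
    then show ?thesis using \<open>card V \<noteq> 0\<close> by simp
  qed
  also have "(\<Sum>g\<in>carrier G. F V \<psi> g) = (\<Sum>g\<in>carrier G. F U \<phi> (g \<otimes> k))"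
  proof (rule sum.cong)
    fix g assume g: "g \<in> carrier G"
    show "F V \<psi> g = F U \<phi> (g \<otimes> k)"
      using conj_into_conj[OF g k(1) Usub H.subset] conj_res_conj_hom[OF g k(1) Usub H.subset]
      by (simp add: F_def V_def \<psi>_def)
  qed simp
  also have "\<dots> = (\<Sum>g\<in>carrier G. F U \<phi> g)"
    by (rule sum.reindex_bij_witness[of _ "\<lambda>g. g \<otimes> inv k" "\<lambda>g. g \<otimes> k"])
      (use k(1) in \<open>auto simp: m_assoc\<close>)
  also have "\<dots> = (\<Sum>g | g \<in> carrier G \<and> conj_into g H U. \<Phi> (conj_res g H \<phi>))"
    using fin by (simp add: F_def sum.inter_filter)
  finally show ?thesis by (simp add: cardV)
qed

end

section \<open>The species are jointly injective\<close>

lemma keys_scale: "Poly_Mapping.keys (scale c x) \<subseteq> Poly_Mapping.keys x"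
  by (auto simp: in_keys_iff)

lemma keys_sum_subset:
  "(\<And>i. i \<in> I \<Longrightarrow> Poly_Mapping.keys (f i) \<subseteq> B) \<Longrightarrow> Poly_Mapping.keys (\<Sum>i\<in>I. f i) \<subseteq> B"
proof (induction I rule: infinite_finite_induct)
  case (insert i I)
  then show ?case using keys_add[of "f i" "sum f I"] by auto
qed simp_all

lemma sum_single_lookup:
  "(\<Sum>b\<in>Poly_Mapping.keys x. Poly_Mapping.single b (Poly_Mapping.lookup x b)) = x"
  by (rule poly_mapping_eqI) (auto simp: lookup_sum lookup_single when_def in_keys_iff)

lemma scale_eq_self:
  assumes "scale c x = x" "c \<noteq> 1"
  shows "x = 0"
proof (rule poly_mapping_eqI)
  fix b
  have "c * Poly_Mapping.lookup x b = Poly_Mapping.lookup x b" using assms(1) lookup_scale by metis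
  then show "Poly_Mapping.lookup x b = Poly_Mapping.lookup 0 b" using assms(2) by simp
qed

lemma orbit_elem_lin_scale: "orbit_elem_lin G A K (scale c a) = scale c (orbit_elem_lin G A K a)"
  by (simp add: orbit_elem_lin_def scale_sum scale_simps)

lemma orbit_elem_lin_add: "orbit_elem_lin G A K (a + b) = orbit_elem_lin G A K a + orbit_elem_lin G A K b"
  by (simp add: orbit_elem_lin_def lookup_add scale_simps sum.distrib)

lemma orbit_elem_lin_sum: "orbit_elem_lin G A K (\<Sum>i\<in>I. a i) = (\<Sum>i\<in>I. orbit_elem_lin G A K (a i))"
  by (induction I rule: infinite_finite_induct)
    (simp_all add: orbit_elem_lin_add, simp_all add: orbit_elem_lin_def scale_simps)

lemma orbit_elem_lin_single:
  assumes "finite (carrier (sub_dual G A K))" "\<psi> \<in> carrier (sub_dual G A K)"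
  shows "orbit_elem_lin G A K (Poly_Mapping.single \<psi> c) = scale c (orbit_elem G K \<psi>)"
proof -
  have "orbit_elem_lin G A K (Poly_Mapping.single \<psi> c) =
      (\<Sum>\<phi>\<in>carrier (sub_dual G A K). if \<phi> = \<psi> then scale c (orbit_elem G K \<psi>) else 0)"
    unfolding orbit_elem_lin_def
    by (intro sum.cong) (auto simp: lookup_single when_def scale_simps)
  then show ?thesis using assms by simp
qed

context fibered_group
begin

lemma group_sub_dual: "subgroup U G \<Longrightarrow> comm_group (sub_dual G A U)"
  by (intro comm_group_hom_group subgroup_imp_group fibre.comm_group_axioms)

lemma sub_dual_mult: "\<phi> \<otimes>\<^bsub>sub_dual G A U\<^esub> \<psi> = (\<lambda>x\<in>U. \<phi> x \<otimes>\<^bsub>A\<^esub> \<psi> x)"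
  by (simp add: mult_hom_group)

lemma xpairs_iff:
  "(H, \<Phi>) \<in> xpairs G A \<longleftrightarrow> subgroup H G \<and> \<Phi> \<in> characters TYPE('k::field) (sub_dual G A H)"
  by (simp add: xpairs_def)

lemma restrict_in_dual:
  assumes "subgroup K G" "K \<subseteq> H" "\<phi> \<in> dual H"
  shows "restrict \<phi> K \<in> dual K"
proof -
  interpret K: subgroup K G by fact
  show ?thesis using assms(2,3) unfolding dual_iff by auto
qed

lemma keys_orbit_elem:
  "subgroup U G \<Longrightarrow> \<phi> \<in> dual U \<Longrightarrow>
    Poly_Mapping.keys (orbit_elem G U \<phi>) \<subseteq> orbits G (mpairs G A) (mconj G)"
  by (auto simp: orbit_elem_def orbits_def mpairs_iff)

text \<open>
  Triangularity with respect to the orders of subgroups. Let \<open>[H, \<theta>]\<close> be an orbit in the support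
  of \<open>x\<close> with \<open>H\<close> of maximal order. Only orbits \<open>[U, \<psi>]\<close> with \<open>U\<close> conjugate to \<open>H\<close> contribute to
  the species at \<open>(H, \<Phi>)\<close>, for any \<open>\<Phi>\<close>. As the characters \<open>\<Phi>\<close> are jointly faithful, the
  coefficient at \<open>\<theta>\<close> of the projected restriction of \<open>x\<close> vanishes; but up to a nonzero rational
  factor this is the coefficient of \<open>x\<close> at \<open>[H, \<theta>]\<close>.
\<close>

lemma species_jointly_injective:
  fixes x :: "('g, 'a, 'k::field_char_0) burnside"
  assumes fin: "finite (carrier G)"
    and fin_dual: "\<And>U. subgroup U G \<Longrightarrow> finite (dual U)"
    and split: "\<And>U. subgroup U G \<Longrightarrow> splitting_field TYPE('k) (sub_dual G A U)"
    and x: "Poly_Mapping.keys x \<subseteq> orbits G (mpairs G A) (mconj G)"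
    and zero: "\<And>q. q \<in> xpairs G A \<Longrightarrow> species G q x = 0"
  shows "x = 0"
proof (rule ccontr)
  assume "x \<noteq> 0"
  then have keys: "Poly_Mapping.keys x \<noteq> {}" "finite (Poly_Mapping.keys x)" by auto
  have "\<forall>ob\<in>Poly_Mapping.keys x. \<exists>p\<in>mpairs G A. ob = orbit G (mconj G) p"
    using x by (auto simp: orbits_def)
  then obtain r where r: "\<And>ob. ob \<in> Poly_Mapping.keys x \<Longrightarrow> r ob \<in> mpairs G A"
    "\<And>ob. ob \<in> Poly_Mapping.keys x \<Longrightarrow> ob = orbit G (mconj G) (r ob)"
    by metis
  define W where "W ob = fst (r ob)" for ob
  define \<theta> where "\<theta> ob = snd (r ob)" for ob
  have W: "subgroup (W ob) G" and \<theta>: "\<theta> ob \<in> dual (W ob)" if "ob \<in> Poly_Mapping.keys x" for ob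
    using r(1)[OF that] by (auto simp: W_def \<theta>_def mpairs_def)
  have ob_eq: "orbit G (mconj G) (W ob, \<theta> ob) = ob" if "ob \<in> Poly_Mapping.keys x" for ob
    using r(2)[OF that] by (simp add: W_def \<theta>_def)
  obtain o0 where o0: "o0 \<in> Poly_Mapping.keys x"
    and max: "\<And>ob. ob \<in> Poly_Mapping.keys x \<Longrightarrow> card (W ob) \<le> card (W o0)"
  proof -
    let ?M = "(\<lambda>ob. card (W ob)) ` Poly_Mapping.keys x"
    have "Max ?M \<in> ?M" using keys by (intro Max_in) auto
    then obtain o0 where o0: "o0 \<in> Poly_Mapping.keys x" "card (W o0) = Max ?M" by fastforce
    have "card (W ob) \<le> card (W o0)" if "ob \<in> Poly_Mapping.keys x" for ob
      unfolding o0(2) using keys that by (intro Max_ge) auto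
    then show thesis using that o0(1) by blast
  qed
  define H where "H = W o0"
  have H: "subgroup H G" using W[OF o0] by (simp add: H_def)
  define N where "N ob = {g \<in> carrier G. conj_into g H (W ob)}" for ob
  have finN: "finite (N ob)" for ob using fin by (simp add: N_def)
  define c where "c ob = Poly_Mapping.lookup x ob / of_nat (card (W ob))" for ob
  \<comment> \<open>\<open>a \<psi>\<close> is the coefficient of \<open>\<psi>\<close> in the projection to \<open>K H\<^sup>*\<close> of the restriction of \<open>x\<close> to \<open>H\<close>.\<close>
  define a where "a \<psi> = (\<Sum>ob\<in>Poly_Mapping.keys x. c ob * of_nat (card {g \<in> N ob. conj_res g H (\<theta> ob) = \<psi>}))" for \<psi>
  have expand: "x = (\<Sum>ob\<in>Poly_Mapping.keys x. scale (Poly_Mapping.lookup x ob) (orbit_elem G (W ob) (\<theta> ob)))"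
  proof -
    have "x = (\<Sum>ob\<in>Poly_Mapping.keys x. Poly_Mapping.single ob (Poly_Mapping.lookup x ob))"
      by (rule sum_single_lookup[symmetric])
    also have "\<dots> = (\<Sum>ob\<in>Poly_Mapping.keys x. scale (Poly_Mapping.lookup x ob) (orbit_elem G (W ob) (\<theta> ob)))"
      by (intro sum.cong) (auto simp: orbit_elem_def ob_eq scale_simps)
    finally show ?thesis .
  qed
  have species: "species G q x = (\<Sum>ob\<in>Poly_Mapping.keys x.
      Poly_Mapping.lookup x ob * species G q (orbit_elem G (W ob) (\<theta> ob)))" for q
    by (rule trans[OF arg_cong[where f = "species G q", OF expand]]) (rule species_linear)
  have "a (\<theta> o0) = 0"
  proof (rule characters_jointly_faithful[OF group_sub_dual[OF H] fin_dual[OF H] split[OF H]])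
    show "\<theta> o0 \<in> dual H" using \<theta>[OF o0] by (simp add: H_def)
    fix \<Phi> assume \<Phi>: "\<Phi> \<in> characters TYPE('k) (sub_dual G A H)"
    have inner_sum: "(\<Sum>g\<in>N ob. \<Phi> (conj_res g H (\<theta> ob))) =
        (\<Sum>\<psi>\<in>dual H. of_nat (card {g \<in> N ob. conj_res g H (\<theta> ob) = \<psi>}) * \<Phi> \<psi>)"
      if ob: "ob \<in> Poly_Mapping.keys x" for ob
    proof -
      have "(\<Sum>g\<in>N ob. \<Phi> (conj_res g H (\<theta> ob))) =
          (\<Sum>\<psi>\<in>dual H. \<Sum>g\<in>{g \<in> N ob. conj_res g H (\<theta> ob) = \<psi>}. \<Phi> (conj_res g H (\<theta> ob)))"
        using finN fin_dual[OF H] conj_res_in_dual[OF _ H \<theta>[OF ob]]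
        by (intro sum.group[symmetric]) (auto simp: N_def)
      then show ?thesis by simp
    qed
    have "0 = species G (H, \<Phi>) x"
      using zero[of "(H, \<Phi>)"] H \<Phi> by (simp add: xpairs_iff)
    also have "\<dots> = (\<Sum>ob\<in>Poly_Mapping.keys x. c ob * (\<Sum>g\<in>N ob. \<Phi> (conj_res g H (\<theta> ob))))"
      unfolding species
      by (intro sum.cong) (simp_all add: species_orbit_elem[OF fin H W \<theta>] c_def N_def)
    also have "\<dots> = (\<Sum>ob\<in>Poly_Mapping.keys x. \<Sum>\<psi>\<in>dual H.
        c ob * of_nat (card {g \<in> N ob. conj_res g H (\<theta> ob) = \<psi>}) * \<Phi> \<psi>)"
      by (intro sum.cong) (simp_all add: inner_sum sum_distrib_left mult.assoc)
    also have "\<dots> = (\<Sum>\<psi>\<in>dual H. a \<psi> * \<Phi> \<psi>)"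
      by (subst sum.swap) (simp add: a_def sum_distrib_right)
    finally show "(\<Sum>\<psi>\<in>dual H. a \<psi> * \<Phi> \<psi>) = 0" by simp
  qed
  moreover have "a (\<theta> o0) = c o0 * of_nat (card {g \<in> N o0. conj_res g H (\<theta> o0) = \<theta> o0})"
  proof -
    have "ob = o0" if ob: "ob \<in> Poly_Mapping.keys x" and g: "g \<in> N ob" "conj_res g H (\<theta> ob) = \<theta> o0" for ob g
    proof -
      have gc: "g \<in> carrier G" and into: "conj_into g H (W ob)" using g by (auto simp: N_def)
      have Wsub: "W ob \<subseteq> carrier G" using W[OF ob] by (rule subgroup.subset)
      have "H \<subseteq> conj_set G g (W ob)"
        using conj_into_iff[OF gc Wsub subgroup.subset[OF H]] into by simp
      moreover have "card (conj_set G g (W ob)) \<le> card H"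
        using max[OF ob] card_conj_set[OF gc Wsub] by (simp add: H_def)
      moreover have "finite (conj_set G g (W ob))"
        using conj_set_subset[OF gc Wsub] fin finite_subset by blast
      ultimately have "H = conj_set G g (W ob)" by (intro card_seteq) auto
      then have eq: "mconj G g (W ob, \<theta> ob) = (W o0, \<theta> o0)"
        using g(2) by (simp add: mconj_eq conj_hom_eq H_def)
      have "mconj G g (W ob, \<theta> ob) \<in> orbit G (mconj G) (W ob, \<theta> ob)"
        using gc unfolding orbit_def by blast
      then have "(W o0, \<theta> o0) \<in> orbit G (mconj G) (W ob, \<theta> ob)" unfolding eq .
      from orbit_eq[OF _ this] show ?thesis
        using W[OF ob] \<theta>[OF ob] ob_eq[OF ob] ob_eq[OF o0] by (simp add: mpairs_iff)
    qed
    then have empty: "{g \<in> N ob. conj_res g H (\<theta> ob) = \<theta> o0} = {}"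
      if "ob \<in> Poly_Mapping.keys x" "ob \<noteq> o0" for ob using that by blast
    have "a (\<theta> o0) = (\<Sum>ob\<in>Poly_Mapping.keys x.
        if ob = o0 then c o0 * of_nat (card {g \<in> N o0. conj_res g H (\<theta> o0) = \<theta> o0}) else 0)"
      unfolding a_def
    proof (rule sum.cong)
      fix ob assume "ob \<in> Poly_Mapping.keys x"
      then show "c ob * of_nat (card {g \<in> N ob. conj_res g H (\<theta> ob) = \<theta> o0}) =
          (if ob = o0 then c o0 * of_nat (card {g \<in> N o0. conj_res g H (\<theta> o0) = \<theta> o0}) else 0)"
        by (cases "ob = o0") (simp_all add: empty)
    qed simp
    then show ?thesis using o0 by simp
  qed
  moreover have "c o0 \<noteq> 0"
  proof -
    have "finite (W o0)" using subgroup.subset[OF W[OF o0]] fin finite_subset by blast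
    moreover have "W o0 \<noteq> {}" using subgroup.one_closed[OF W[OF o0]] by blast
    ultimately show ?thesis using o0 by (simp add: c_def in_keys_iff)
  qed
  moreover have one_mem: "\<one> \<in> {g \<in> N o0. conj_res g H (\<theta> o0) = \<theta> o0}"
  proof -
    have sub: "H \<subseteq> carrier G" using H by (rule subgroup.subset)
    have "conj_into \<one> H (W o0)" using sub by (auto simp: conj_into_def H_def)
    moreover have "conj_res \<one> H (\<theta> o0) = \<theta> o0"
    proof (rule extensionalityI[of _ H])
      show "\<theta> o0 \<in> extensional H" using \<theta>[OF o0] unfolding H_def dual_iff by blast
      show "conj_res \<one> H (\<theta> o0) y = \<theta> o0 y" if "y \<in> H" for y
        using that sub by (auto simp: conj_res_def subset_iff)
    qed (simp add: conj_res_def)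
    ultimately show ?thesis by (simp add: N_def)
  qed
  then have "card {g \<in> N o0. conj_res g H (\<theta> o0) = \<theta> o0} \<noteq> 0"
    using finN[of o0] by (simp only: card_eq_0_iff) auto
  ultimately show False by simp
qed

end

section \<open>The dual Moebius identity\<close>

lemma moebius_self: "moebius P x x = 1"
  by (subst moebius.simps) simp

lemma moebius_sum_lower:
  assumes "finite P" "x \<in> P" "y \<in> P" "x \<le> y"
  shows "(\<Sum>z\<in>{z \<in> P. x \<le> z \<and> z \<le> y}. moebius P x z) = (if x = y then 1 else 0)"
proof (cases "x = y")
  case True
  then have "{z \<in> P. x \<le> z \<and> z \<le> y} = {x}" using assms by auto
  then show ?thesis using True by (simp add: moebius_self)
next
  case False
  then have "{z \<in> P. x \<le> z \<and> z \<le> y} = insert y {z \<in> P. x \<le> z \<and> z < y}"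
    using assms by auto
  then have "(\<Sum>z\<in>{z \<in> P. x \<le> z \<and> z \<le> y}. moebius P x z) =
      moebius P x y + (\<Sum>z\<in>{z \<in> P. x \<le> z \<and> z < y}. moebius P x z)"
    using assms(1) by simp
  moreover have "moebius P x y = - (\<Sum>z\<in>{z \<in> P. x \<le> z \<and> z < y}. moebius P x z)"
    using assms(1) False order.not_eq_order_implies_strict[OF False assms(4)]
    by (subst moebius.simps) (simp only: if_False if_True simp_thms)
  ultimately show ?thesis using False by simp
qed

text \<open>
  The definition says that \<open>\<mu>\<close> is inverse to the zeta function from one side; this is the other
  side. With \<open>S x\<close> the sum in question, \<open>\<Sum> \<mu>(x,z) S z\<close> over \<open>x \<le> z \<le> y\<close> equals \<open>\<mu>(x,y)\<close> by
  interchanging the two summations, while induction evaluates all its terms but the one at \<open>z = x\<close>.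
\<close>

lemma moebius_sum_upper:
  assumes P: "finite P" and y: "y \<in> P" and x: "x \<in> P" "x \<le> y"
  shows "(\<Sum>z\<in>{z \<in> P. x \<le> z \<and> z \<le> y}. moebius P z y) = (if x = y then 1 else 0)"
  using x
proof (induction "card {z \<in> P. x \<le> z}" arbitrary: x rule: less_induct)
  case less
  define S where "S x = (\<Sum>z\<in>{z \<in> P. x \<le> z \<and> z \<le> y}. moebius P z y)" for x
  have S_above: "S z = (if z = y then 1 else 0)" if "z \<in> P" "x < z" "z \<le> y" for z
  proof -
    have "{w \<in> P. z \<le> w} \<subseteq> {w \<in> P. x \<le> w}" using that by auto
    moreover have "x \<in> {w \<in> P. x \<le> w}" "x \<notin> {w \<in> P. z \<le> w}" using that less.prems by auto
    ultimately have "{w \<in> P. z \<le> w} \<subset> {w \<in> P. x \<le> w}" by blast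
    then have "card {w \<in> P. z \<le> w} < card {w \<in> P. x \<le> w}"
      using P by (intro psubset_card_mono) auto
    then show ?thesis unfolding S_def using that by (intro less.hyps) auto
  qed
  let ?I = "{z \<in> P. x \<le> z \<and> z \<le> y}"
  have fin: "finite ?I" using P by simp
  have "(\<Sum>z\<in>?I. moebius P x z * S z) =
      (\<Sum>z\<in>?I. \<Sum>w\<in>{w \<in> ?I. z \<le> w}. moebius P x z * moebius P w y)"
    unfolding S_def sum_distrib_left by (intro sum.cong) (auto intro: order_trans)
  also have "\<dots> = (\<Sum>w\<in>?I. \<Sum>z\<in>{z \<in> ?I. z \<le> w}. moebius P x z * moebius P w y)"
    by (rule sum.swap_restrict[OF fin fin])
  also have "\<dots> = (\<Sum>w\<in>?I. (if x = w then 1 else 0) * moebius P w y)"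
  proof (rule sum.cong)
    fix w assume w: "w \<in> ?I"
    have "{z \<in> ?I. z \<le> w} = {z \<in> P. x \<le> z \<and> z \<le> w}" using w by auto
    then show "(\<Sum>z\<in>{z \<in> ?I. z \<le> w}. moebius P x z * moebius P w y) =
        (if x = w then 1 else 0) * moebius P w y"
      using moebius_sum_lower[OF P less.prems(1), of w] w by (simp flip: sum_distrib_right)
  qed simp
  also have "\<dots> = (\<Sum>w\<in>?I. if x = w then moebius P w y else 0)" by (intro sum.cong) auto
  also have "\<dots> = moebius P x y" using less.prems fin by simp
  finally have total: "(\<Sum>z\<in>?I. moebius P x z * S z) = moebius P x y" .
  have "(\<Sum>z\<in>?I. moebius P x z * S z) = moebius P x x * S x + (\<Sum>z\<in>?I - {x}. moebius P x z * S z)"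
    by (rule sum.remove[OF fin]) (use less.prems in simp)
  also have "(\<Sum>z\<in>?I - {x}. moebius P x z * S z) = (\<Sum>z\<in>?I - {x}. if z = y then moebius P x y else 0)"
    using S_above by (intro sum.cong) auto
  also have "\<dots> = (if x = y then 0 else moebius P x y)"
    using fin y less.prems by auto
  finally have "S x = moebius P x y - (if x = y then 0 else moebius P x y)"
    using total by (simp add: moebius_self)
  then have "S x = (if x = y then 1 else 0)"
    by (cases "x = y") (simp_all add: moebius_self)
  then show ?case unfolding S_def .
qed

section \<open>The idempotent formula\<close>

context fibered_group
begin

lemma conj_hom_conj_hom:
  assumes "g \<in> carrier G" "h \<in> carrier G" "subgroup U G" "\<phi> \<in> dual U"
  shows "conj_hom G g (conj_set G h U) (conj_hom G h U \<phi>) = conj_hom G (g \<otimes> h) U \<phi>"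
  using mconj_mconj[of g h "(U, \<phi>)"] assms by (simp add: mconj_eq mpairs_iff)

lemma conj_hom_one: "subgroup U G \<Longrightarrow> \<phi> \<in> dual U \<Longrightarrow> conj_hom G \<one> U \<phi> = \<phi>"
  using mconj_one[of "(U, \<phi>)"] by (simp add: mconj_eq mpairs_iff)

lemma xconj_xconj:
  assumes g: "g \<in> carrier G" and h: "h \<in> carrier G" and H: "subgroup H G"
  shows "xconj G A g (xconj G A h (H, \<Phi>)) = xconj G A (g \<otimes> h) (H, \<Phi>)"
proof -
  let ?hH = "conj_set G h H" and ?ghH = "conj_set G (g \<otimes> h) H"
  have Hsub: "H \<subseteq> carrier G" using H by (rule subgroup.subset)
  have ghH: "conj_set G g ?hH = ?ghH" by (rule conj_set_conj_set[OF g h Hsub])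
  have return_set: "conj_set G (inv g) ?ghH = ?hH"
    using g h Hsub by (simp add: conj_set_conj_set m_assoc[symmetric])
  have sub: "subgroup ?ghH G" using g h H by (simp add: subgroup_conj_set)
  have "conj_hom G (inv g) ?ghH \<psi> \<in> dual ?hH \<and>
      conj_hom G (inv h) ?hH (conj_hom G (inv g) ?ghH \<psi>) = conj_hom G (inv (g \<otimes> h)) ?ghH \<psi>"
    if \<psi>: "\<psi> \<in> dual ?ghH" for \<psi>
    using conj_hom_in_dual[OF _ sub \<psi>, of "inv g"] conj_hom_conj_hom[OF _ _ sub \<psi>, of "inv h" "inv g"]
      g h by (simp add: return_set inv_mult_group)
  then show ?thesis
    by (auto simp: xconj_def ghH intro!: restrict_ext)
qed

lemma xconj_one:
  assumes "(H, \<Phi>) \<in> xpairs G A"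
  shows "xconj G A \<one> (H, \<Phi>) = (H, \<Phi>)"
proof -
  have H: "subgroup H G" using assms by (simp add: xpairs_iff)
  have Hsub: "H \<subseteq> carrier G" using H by (rule subgroup.subset)
  have ext: "\<Phi> \<in> extensional (dual H)" using assms unfolding xpairs_iff character_iff by blast
  have "(\<lambda>\<phi>\<in>dual H. \<Phi> (conj_hom G \<one> H \<phi>)) = \<Phi>"
    by (rule extensionalityI[OF _ ext]) (auto simp: conj_hom_one[OF H])
  then show ?thesis by (simp add: xconj_def conj_set_one[OF Hsub])
qed

lemma xconj_eq_iff:
  assumes g: "g \<in> carrier G" and H: "subgroup H G" and \<Psi>: "(L, \<Psi>) \<in> xpairs G A"
    and \<Phi>: "\<Phi> \<in> extensional (dual H)"
  shows "xconj G A g (H, \<Phi>) = (L, \<Psi>) \<longleftrightarrow>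
    L = conj_set G g H \<and> (\<forall>\<phi>\<in>dual H. \<Psi> (conj_hom G g H \<phi>) = \<Phi> \<phi>)"
proof -
  let ?gH = "conj_set G g H"
  have Hsub: "H \<subseteq> carrier G" using H by (rule subgroup.subset)
  have gH: "subgroup ?gH G" by (rule subgroup_conj_set[OF g H])
  have return_set: "conj_set G (inv g) ?gH = H"
    using g Hsub by (simp add: conj_set_conj_set conj_set_one)
  have there: "conj_hom G (inv g) ?gH (conj_hom G g H \<phi>) = \<phi>" if "\<phi> \<in> dual H" for \<phi>
    using conj_hom_conj_hom[OF _ g H that, of "inv g"] g conj_hom_one[OF H that] by simp
  have again: "conj_hom G (inv g) ?gH \<psi> \<in> dual H"
      "conj_hom G g H (conj_hom G (inv g) ?gH \<psi>) = \<psi>" if "\<psi> \<in> dual ?gH" for \<psi>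
    using conj_hom_in_dual[OF _ gH that, of "inv g"] conj_hom_conj_hom[OF g _ gH that, of "inv g"]
      g conj_hom_one[OF gH that] by (simp_all add: return_set)
  show ?thesis
  proof
    assume eq: "xconj G A g (H, \<Phi>) = (L, \<Psi>)"
    have "\<Psi> (conj_hom G g H \<phi>) = \<Phi> \<phi>" if "\<phi> \<in> dual H" for \<phi>
      using eq there[OF that] conj_hom_in_dual[OF g H that] by (auto simp: xconj_def)
    then show "L = ?gH \<and> (\<forall>\<phi>\<in>dual H. \<Psi> (conj_hom G g H \<phi>) = \<Phi> \<phi>)"
      using eq by (auto simp: xconj_def)
  next
    assume *: "L = ?gH \<and> (\<forall>\<phi>\<in>dual H. \<Psi> (conj_hom G g H \<phi>) = \<Phi> \<phi>)"
    have "(\<lambda>\<psi>\<in>dual ?gH. \<Phi> (conj_hom G (inv g) ?gH \<psi>)) = \<Psi>"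
    proof (rule extensionalityI[of _ "dual ?gH"])
      show "\<Psi> \<in> extensional (dual ?gH)"
        using \<Psi> * unfolding xpairs_iff character_iff by blast
      show "(\<lambda>\<psi>\<in>dual ?gH. \<Phi> (conj_hom G (inv g) ?gH \<psi>)) \<psi> = \<Psi> \<psi>" if \<psi>: "\<psi> \<in> dual ?gH" for \<psi>
      proof -
        have "\<Psi> (conj_hom G g H (conj_hom G (inv g) ?gH \<psi>)) = \<Phi> (conj_hom G (inv g) ?gH \<psi>)"
          using * again(1)[OF \<psi>] by blast
        then show ?thesis using \<psi> again(2)[OF \<psi>] by simp
      qed
    qed simp
    then show "xconj G A g (H, \<Phi>) = (L, \<Psi>)" using * by (simp add: xconj_def)
  qed
qed

text \<open>
  The elements carrying \<open>(H, \<Phi>)\<close> to a given conjugate form a coset of the stabilizer.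
\<close>

lemma card_transporter:
  assumes p: "(H, \<Phi>) \<in> xpairs G A"
  shows "card {g \<in> carrier G. xconj G A g (H, \<Phi>) = q} =
    (if q \<in> orbit G (xconj G A) (H, \<Phi>) then card (stabilizer G (xconj G A) (H, \<Phi>)) else 0)"
proof (cases "q \<in> orbit G (xconj G A) (H, \<Phi>)")
  case False
  then have "{g \<in> carrier G. xconj G A g (H, \<Phi>) = q} = {}" by (auto simp: orbit_def)
  then show ?thesis using False by (simp only: if_False card.empty)
next
  case True
  have H: "subgroup H G" using p by (simp add: xpairs_iff)
  obtain k where k: "k \<in> carrier G" "q = xconj G A k (H, \<Phi>)" using True by (auto simp: orbit_def)
  have comp: "xconj G A g (xconj G A h (H, \<Phi>)) = xconj G A (g \<otimes> h) (H, \<Phi>)"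
    if "g \<in> carrier G" "h \<in> carrier G" for g h using xconj_xconj[OF that H] .
  have "{g \<in> carrier G. xconj G A g (H, \<Phi>) = q} = (\<lambda>s. k \<otimes> s) ` stabilizer G (xconj G A) (H, \<Phi>)"
  proof (intro equalityI subsetI)
    fix g assume "g \<in> {g \<in> carrier G. xconj G A g (H, \<Phi>) = q}"
    then have g: "g \<in> carrier G" "xconj G A g (H, \<Phi>) = xconj G A k (H, \<Phi>)" using k by auto
    have "xconj G A (inv k \<otimes> g) (H, \<Phi>) = xconj G A (inv k) (xconj G A k (H, \<Phi>))"
      using comp[of "inv k" g] g k by simp
    also have "\<dots> = (H, \<Phi>)" using comp[of "inv k" k] k xconj_one[OF p] by simp
    finally have "inv k \<otimes> g \<in> stabilizer G (xconj G A) (H, \<Phi>)"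
      using g k by (simp add: stabilizer_def)
    moreover have "g = k \<otimes> (inv k \<otimes> g)" using g k by (simp add: m_assoc[symmetric])
    ultimately show "g \<in> (\<lambda>s. k \<otimes> s) ` stabilizer G (xconj G A) (H, \<Phi>)" by blast
  next
    fix g assume "g \<in> (\<lambda>s. k \<otimes> s) ` stabilizer G (xconj G A) (H, \<Phi>)"
    then obtain s where s: "s \<in> carrier G" "xconj G A s (H, \<Phi>) = (H, \<Phi>)" "g = k \<otimes> s"
      by (auto simp: stabilizer_def)
    then show "g \<in> {g \<in> carrier G. xconj G A g (H, \<Phi>) = q}"
      using comp[of k s] k by simp
  qed
  moreover have "inj_on (\<lambda>s. k \<otimes> s) (stabilizer G (xconj G A) (H, \<Phi>))"
    by (rule inj_on_subset[OF inj_on_cmult[OF k(1)]]) (auto simp: stabilizer_def)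
  ultimately show ?thesis using True by (simp add: card_image)
qed

text \<open>
  Transporting \<open>\<Psi>\<close> back along conjugation by \<open>g\<close> gives a character of \<open>H\<^sup>*\<close>, to which the
  orthogonality relation applies.
\<close>

lemma conj_character_orthogonality:
  fixes \<Phi> \<Psi> :: "('g \<Rightarrow> 'a) \<Rightarrow> 'k::field"
  assumes fin_dual: "finite (dual H)" and p: "(H, \<Phi>) \<in> xpairs G A" and q: "(L, \<Psi>) \<in> xpairs G A"
    and g: "g \<in> carrier G" and L: "L = conj_set G g H"
  shows "(\<Sum>\<phi>\<in>dual H. \<Phi> (inv\<^bsub>sub_dual G A H\<^esub> \<phi>) * \<Psi> (conj_res g L \<phi>)) =
    (if xconj G A g (H, \<Phi>) = (L, \<Psi>) then of_nat (card (dual H)) else 0)"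
proof -
  have H: "subgroup H G" and \<Phi>: "\<Phi> \<in> characters TYPE('k) (sub_dual G A H)"
    using p by (simp_all add: xpairs_iff)
  have \<Psi>: "\<Psi> \<in> characters TYPE('k) (sub_dual G A L)" using q by (simp add: xpairs_iff)
  interpret D: comm_group "sub_dual G A H" by (rule group_sub_dual[OF H])
  define \<chi> where "\<chi> = (\<lambda>\<phi>\<in>dual H. \<Psi> (conj_hom G g H \<phi>))"
  have Hsub: "H \<subseteq> carrier G" using H by (rule subgroup.subset)
  have mult: "conj_hom G g H (\<phi> \<otimes>\<^bsub>sub_dual G A H\<^esub> \<psi>) =
      conj_hom G g H \<phi> \<otimes>\<^bsub>sub_dual G A L\<^esub> conj_hom G g H \<psi>" for \<phi> \<psi>
    unfolding sub_dual_mult L conj_hom_def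
    by (intro restrict_ext) (simp add: conj_set_eq[OF g Hsub])
  have closed: "conj_hom G g H \<phi> \<in> dual L" if "\<phi> \<in> dual H" for \<phi>
    unfolding L by (rule conj_hom_in_dual[OF g H that])
  have \<chi>: "\<chi> \<in> characters TYPE('k) (sub_dual G A H)"
    using \<Psi> closed D.m_closed unfolding character_iff \<chi>_def by (auto simp: mult)
  have "(\<Sum>\<phi>\<in>dual H. \<Phi> (inv\<^bsub>sub_dual G A H\<^esub> \<phi>) * \<Psi> (conj_res g L \<phi>)) =
      (\<Sum>\<phi>\<in>dual H. \<Phi> (inv\<^bsub>sub_dual G A H\<^esub> \<phi>) * \<chi> \<phi>)"
    by (intro sum.cong) (simp_all add: \<chi>_def L conj_hom_eq)
  also have "\<dots> = (if \<chi> = \<Phi> then of_nat (card (dual H)) else 0)"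
    by (rule character_orthogonality[OF D.comm_group_axioms fin_dual \<Phi> \<chi>])
  also have "\<chi> = \<Phi> \<longleftrightarrow> xconj G A g (H, \<Phi>) = (L, \<Psi>)"
  proof -
    have ext: "\<Phi> \<in> extensional (dual H)" using \<Phi> unfolding character_iff by blast
    have "\<chi> = \<Phi> \<longleftrightarrow> (\<forall>\<phi>\<in>dual H. \<Psi> (conj_hom G g H \<phi>) = \<Phi> \<phi>)"
    proof
      assume "\<chi> = \<Phi>"
      then show "\<forall>\<phi>\<in>dual H. \<Psi> (conj_hom G g H \<phi>) = \<Phi> \<phi>" unfolding \<chi>_def by (metis restrict_apply')
    next
      assume "\<forall>\<phi>\<in>dual H. \<Psi> (conj_hom G g H \<phi>) = \<Phi> \<phi>"
      then show "\<chi> = \<Phi>" by (intro extensionalityI[OF _ ext]) (auto simp: \<chi>_def)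
    qed
    then show ?thesis using xconj_eq_iff[OF g H q ext] L by simp
  qed
  finally show ?thesis .
qed

text \<open>
  Up to the factor \<open>1 / |H\<^sup>*|\<close> this is the element \<open>[K, res e\<^sub>\<Phi>]\<close> attached to \<open>K\<close>.
\<close>

definition twisted_sum :: "'g set \<Rightarrow> (('g \<Rightarrow> 'a) \<Rightarrow> 'k::field) \<Rightarrow> 'g set \<Rightarrow> ('g, 'a, 'k) burnside" where
  "twisted_sum H \<Phi> K =
    (\<Sum>\<phi>\<in>dual H. scale (\<Phi> (inv\<^bsub>sub_dual G A H\<^esub> \<phi>)) (orbit_elem G K (restrict \<phi> K)))"

lemma orbit_elem_lin_dual_res_dual_idem:
  fixes \<Phi> :: "('g \<Rightarrow> 'a) \<Rightarrow> 'k::field"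
  assumes fin_dual: "finite (dual K)" and K: "subgroup K G" "K \<subseteq> H"
  shows "orbit_elem_lin G A K (dual_res K (dual_idem G A H \<Phi>)) =
    scale (1 / of_nat (card (dual H))) (twisted_sum H \<Phi> K)"
proof -
  have "dual_res K (dual_idem G A H \<Phi>) = scale (1 / of_nat (card (dual H)))
      (\<Sum>\<phi>\<in>dual H. Poly_Mapping.single (restrict \<phi> K) (\<Phi> (inv\<^bsub>sub_dual G A H\<^esub> \<phi>)))"
    by (simp add: dual_res_def dual_idem_def linear_ext_scale linear_ext_sum scale_simps)
  also have "orbit_elem_lin G A K \<dots> = scale (1 / of_nat (card (dual H))) (twisted_sum H \<Phi> K)"
    unfolding orbit_elem_lin_scale orbit_elem_lin_sum twisted_sum_def
    by (intro arg_cong[of _ _ "scale _"] sum.cong refl orbit_elem_lin_single fin_dual restrict_in_dual)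
      (use K in auto)
  finally show ?thesis .
qed

text \<open>
  Multiplying the summation variable by \<open>\<chi>\<close> leaves all restrictions to \<open>K\<close> unchanged but
  multiplies the sum by the inverse of \<open>\<Phi> \<chi>\<close>.
\<close>

lemma twisted_sum_eq_zero:
  fixes \<Phi> :: "('g \<Rightarrow> 'a) \<Rightarrow> 'k::field"
  assumes p: "(H, \<Phi>) \<in> xpairs G A" and KH: "K \<subseteq> H"
    and \<chi>: "\<chi> \<in> perp G A H K" "\<Phi> \<chi> \<noteq> 1"
  shows "twisted_sum H \<Phi> K = 0"
proof -
  have H: "subgroup H G" and \<Phi>: "\<Phi> \<in> characters TYPE('k) (sub_dual G A H)"
    using p by (simp_all add: xpairs_iff)
  let ?D = "sub_dual G A H"
  interpret D: comm_group ?D by (rule group_sub_dual[OF H])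
  have \<chi>H: "\<chi> \<in> dual H" and \<chi>K: "\<And>x. x \<in> K \<Longrightarrow> \<chi> x = \<one>\<^bsub>A\<^esub>" using \<chi>(1) by (auto simp: perp_def)
  have inv_mult: "\<Phi> (inv\<^bsub>?D\<^esub> (\<chi> \<otimes>\<^bsub>?D\<^esub> \<phi>)) = \<Phi> (inv\<^bsub>?D\<^esub> \<chi>) * \<Phi> (inv\<^bsub>?D\<^esub> \<phi>)"
    if "\<phi> \<in> dual H" for \<phi>
  proof -
    have "\<Phi> (inv\<^bsub>?D\<^esub> \<chi> \<otimes>\<^bsub>?D\<^esub> inv\<^bsub>?D\<^esub> \<phi>) = \<Phi> (inv\<^bsub>?D\<^esub> \<chi>) * \<Phi> (inv\<^bsub>?D\<^esub> \<phi>)"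
      using \<Phi> D.inv_closed[OF \<chi>H] D.inv_closed[OF that] unfolding character_iff by blast
    then show ?thesis using D.inv_mult[OF \<chi>H that] by simp
  qed
  have restr: "restrict (\<chi> \<otimes>\<^bsub>?D\<^esub> \<phi>) K = restrict \<phi> K" if \<phi>: "\<phi> \<in> dual H" for \<phi>
  proof (rule restrict_ext)
    fix x assume x: "x \<in> K"
    then have "\<phi> x \<in> carrier A" "x \<in> H" using \<phi> KH unfolding dual_iff by auto
    then show "(\<chi> \<otimes>\<^bsub>?D\<^esub> \<phi>) x = \<phi> x" using \<chi>K[OF x] by (simp add: sub_dual_mult)
  qed
  have "scale (\<Phi> (inv\<^bsub>?D\<^esub> \<chi>)) (twisted_sum H \<Phi> K) =
      (\<Sum>\<phi>\<in>dual H. scale (\<Phi> (inv\<^bsub>?D\<^esub> (\<chi> \<otimes>\<^bsub>?D\<^esub> \<phi>))) (orbit_elem G K (restrict (\<chi> \<otimes>\<^bsub>?D\<^esub> \<phi>) K)))"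
    unfolding twisted_sum_def scale_sum
    by (intro sum.cong) (simp_all only: scale_simps inv_mult restr)
  also have "\<dots> = twisted_sum H \<Phi> K"
    unfolding twisted_sum_def
    using D.inj_on_cmult[OF \<chi>H] D.surj_const_mult[OF \<chi>H]
    by (intro sum.reindex_bij_betw[of "\<lambda>\<phi>. \<chi> \<otimes>\<^bsub>?D\<^esub> \<phi>" _ _ "\<lambda>\<phi>. scale (\<Phi> (inv\<^bsub>?D\<^esub> \<phi>)) (orbit_elem G K (restrict \<phi> K))"])
      (simp add: bij_betw_def)
  finally show ?thesis
  proof (rule scale_eq_self)
    show "\<Phi> (inv\<^bsub>?D\<^esub> \<chi>) \<noteq> 1"
      using character_inv[OF D.is_group \<Phi> \<chi>H] \<chi>(2) by simp
  qed
qed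

lemma subgroup_of_subgroup_iff:
  assumes H: "subgroup H G"
  shows "subgroup K (G\<lparr>carrier := H\<rparr>) \<longleftrightarrow> subgroup K G \<and> K \<subseteq> H"
proof
  assume K: "subgroup K (G\<lparr>carrier := H\<rparr>)"
  show "subgroup K G \<and> K \<subseteq> H"
    using incl_subgroup[OF H K] subgroup.subset[OF K] by simp
next
  assume "subgroup K G \<and> K \<subseteq> H"
  then show "subgroup K (G\<lparr>carrier := H\<rparr>)" using subgroup_incl[OF _ H] by blast
qed

lemma finite_subgroups: "finite (carrier G) \<Longrightarrow> finite {U. subgroup U G}"
  by (rule finite_subset[of _ "Pow (carrier G)"]) (auto dest: subgroup.subset)

lemma sum_moebius_conj_into:
  assumes fin: "finite (carrier G)" and H: "subgroup H G" and L: "subgroup L G" and g: "g \<in> carrier G"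
  shows "(\<Sum>K | subgroup K (G\<lparr>carrier := H\<rparr>) \<and> conj_into g L K. moebius {U. subgroup U G} K H) =
    (if L = conj_set G g H then 1 else 0)"
proof -
  let ?P = "{U. subgroup U G}"
  define M where "M = conj_set G (inv g) L"
  have Lsub: "L \<subseteq> carrier G" and Hsub: "H \<subseteq> carrier G" using L H by (auto dest: subgroup.subset)
  have M: "subgroup M G" unfolding M_def using g by (intro subgroup_conj_set L) simp
  have Msub: "M \<subseteq> carrier G" using M by (rule subgroup.subset)
  have gM: "conj_set G g M = L"
    unfolding M_def using g Lsub by (simp add: conj_set_conj_set conj_set_one)
  have "inner g ` L = M" using inner_image_conj_set[OF g Msub] gM by simp
  then have into: "conj_into g L K \<longleftrightarrow> M \<subseteq> K" for K by (auto simp: conj_into_def)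
  have set_eq: "{K. subgroup K (G\<lparr>carrier := H\<rparr>) \<and> conj_into g L K} = {K \<in> ?P. M \<subseteq> K \<and> K \<subseteq> H}"
    by (auto simp: into subgroup_of_subgroup_iff[OF H])
  show ?thesis
  proof (cases "M \<subseteq> H")
    case True
    have "(\<Sum>K | subgroup K (G\<lparr>carrier := H\<rparr>) \<and> conj_into g L K. moebius ?P K H) = (if M = H then 1 else 0)"
      unfolding set_eq using finite_subgroups[OF fin] M H True by (intro moebius_sum_upper) auto
    moreover have "M = H \<longleftrightarrow> L = conj_set G g H"
      using gM inner_image_conj_set[OF g Msub] inner_image_conj_set[OF g Hsub] by metis
    ultimately show ?thesis by simp
  next
    case False
    then have empty: "{K. subgroup K (G\<lparr>carrier := H\<rparr>) \<and> conj_into g L K} = {}" unfolding set_eq by auto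
    have "L \<noteq> conj_set G g H"
      using False gM inner_image_conj_set[OF g Msub] inner_image_conj_set[OF g Hsub] by auto
    then show ?thesis unfolding empty by simp
  qed
qed

text \<open>
  By the formula for species on basis elements the left side is a sum over \<open>K\<close>, \<open>\<phi>\<close> and \<open>g\<close>,
  in which \<open>|K|\<close> cancels. For fixed \<open>g\<close> the sum over \<open>K\<close> involves only \<open>\<mu>(K,H)\<close> for \<open>K\<close> between
  \<open>g\<^sup>-\<^sup>1 L g\<close> and \<open>H\<close>, so it selects \<open>L = g H g\<^sup>-\<^sup>1\<close>. The sum over \<open>\<phi>\<close> then selects the \<open>g\<close> that
  carry \<open>(H, \<Phi>)\<close> to \<open>(L, \<Psi>)\<close>, and these are counted by the stabilizer.
\<close>

lemma species_moebius_sum: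
  fixes \<Phi> :: "('g \<Rightarrow> 'a) \<Rightarrow> 'k::field_char_0"
  assumes fin: "finite (carrier G)" and fin_dual: "finite (dual H)"
    and p: "(H, \<Phi>) \<in> xpairs G A" and q: "q \<in> xpairs G A"
  shows "species G q (\<Sum>K | subgroup K (G\<lparr>carrier := H\<rparr>).
      scale (of_nat (card K) * of_int (moebius {U. subgroup U G} K H)) (twisted_sum H \<Phi> K)) =
    of_nat (card (dual H)) *
      (if q \<in> orbit G (xconj G A) (H, \<Phi>) then of_nat (card (stabilizer G (xconj G A) (H, \<Phi>))) else 0)"
proof -
  obtain L \<Psi> where q_eq: "q = (L, \<Psi>)" by (cases q)
  have H: "subgroup H G" using p by (simp add: xpairs_iff)
  have L: "subgroup L G" using q by (simp add: q_eq xpairs_iff)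
  let ?D = "sub_dual G A H"
  let ?S = "{K. subgroup K (G\<lparr>carrier := H\<rparr>)}"
  define m where "m K = (of_int (moebius {U. subgroup U G} K H) :: 'k)" for K
  have K: "subgroup K G" "K \<subseteq> H" "of_nat (card K) \<noteq> (0 :: 'k)" if "K \<in> ?S" for K
  proof -
    show KG: "subgroup K G" "K \<subseteq> H"
      using that by (simp_all add: subgroup_of_subgroup_iff[OF H])
    have "finite K" using subgroup.subset[OF KG(1)] fin finite_subset by blast
    then show "of_nat (card K) \<noteq> (0 :: 'k)" using subgroup.one_closed[OF KG(1)] by auto
  qed
  have finS: "finite ?S"
    by (simp add: subgroup_of_subgroup_iff[OF H] finite_subgroups[OF fin])
  have species_term: "of_nat (card K) * m K * species G (L, \<Psi>) (twisted_sum H \<Phi> K) =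
      (\<Sum>g\<in>carrier G. (if conj_into g L K then m K else 0) *
        (\<Sum>\<phi>\<in>dual H. \<Phi> (inv\<^bsub>?D\<^esub> \<phi>) * \<Psi> (conj_res g L \<phi>)))" if KS: "K \<in> ?S" for K
  proof -
    have "species G (L, \<Psi>) (twisted_sum H \<Phi> K) = (\<Sum>\<phi>\<in>dual H. \<Phi> (inv\<^bsub>?D\<^esub> \<phi>) *
        ((\<Sum>g | g \<in> carrier G \<and> conj_into g L K. \<Psi> (conj_res g L \<phi>)) / of_nat (card K)))"
      unfolding twisted_sum_def species_linear
    proof (intro sum.cong refl arg_cong2[of _ _ _ _ "(*)"])
      fix \<phi> assume \<phi>: "\<phi> \<in> dual H"
      have "conj_res g L (restrict \<phi> K) = conj_res g L \<phi>" if "conj_into g L K" for g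
        using that unfolding conj_res_def conj_into_def by (intro restrict_ext) simp
      then show "species G (L, \<Psi>) (orbit_elem G K (restrict \<phi> K)) =
          (\<Sum>g | g \<in> carrier G \<and> conj_into g L K. \<Psi> (conj_res g L \<phi>)) / of_nat (card K)"
        using species_orbit_elem[OF fin L K(1)[OF KS] restrict_in_dual[OF K(1,2)[OF KS] \<phi>], of \<Psi>]
        by simp
    qed
    then have "of_nat (card K) * m K * species G (L, \<Psi>) (twisted_sum H \<Phi> K) =
        m K * (\<Sum>\<phi>\<in>dual H. \<Sum>g | g \<in> carrier G \<and> conj_into g L K. \<Phi> (inv\<^bsub>?D\<^esub> \<phi>) * \<Psi> (conj_res g L \<phi>))"
      using K(3)[OF KS] by (simp add: sum_distrib_left sum_divide_distrib field_simps)
    also have "\<dots> = (\<Sum>g | g \<in> carrier G \<and> conj_into g L K.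
        m K * (\<Sum>\<phi>\<in>dual H. \<Phi> (inv\<^bsub>?D\<^esub> \<phi>) * \<Psi> (conj_res g L \<phi>)))"
      by (subst sum.swap) (simp add: sum_distrib_left)
    also have "\<dots> = (\<Sum>g\<in>carrier G. (if conj_into g L K then m K else 0) *
        (\<Sum>\<phi>\<in>dual H. \<Phi> (inv\<^bsub>?D\<^esub> \<phi>) * \<Psi> (conj_res g L \<phi>)))"
      using fin by (intro sum.mono_neutral_cong_left) auto
    finally show ?thesis .
  qed
  have "species G q (\<Sum>K\<in>?S. scale (of_nat (card K) * m K) (twisted_sum H \<Phi> K)) =
      (\<Sum>K\<in>?S. \<Sum>g\<in>carrier G. (if conj_into g L K then m K else 0) *
        (\<Sum>\<phi>\<in>dual H. \<Phi> (inv\<^bsub>?D\<^esub> \<phi>) * \<Psi> (conj_res g L \<phi>)))"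
    unfolding species_linear q_eq by (intro sum.cong refl species_term)
  also have "\<dots> = (\<Sum>g\<in>carrier G. (\<Sum>K\<in>?S. if conj_into g L K then m K else 0) *
        (\<Sum>\<phi>\<in>dual H. \<Phi> (inv\<^bsub>?D\<^esub> \<phi>) * \<Psi> (conj_res g L \<phi>)))"
    by (subst sum.swap) (simp add: sum_distrib_right)
  also have "\<dots> = (\<Sum>g\<in>carrier G.
      if xconj G A g (H, \<Phi>) = (L, \<Psi>) then of_nat (card (dual H)) else 0)"
  proof (rule sum.cong)
    fix g assume g: "g \<in> carrier G"
    have "(\<Sum>K\<in>?S. if conj_into g L K then m K else 0) =
        of_int (\<Sum>K | subgroup K (G\<lparr>carrier := H\<rparr>) \<and> conj_into g L K. moebius {U. subgroup U G} K H)"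
      using finS by (simp add: m_def flip: sum.inter_filter)
    then have mu: "(\<Sum>K\<in>?S. if conj_into g L K then m K else 0) = (if L = conj_set G g H then 1 else 0)"
      using sum_moebius_conj_into[OF fin H L g] by simp
    show "(\<Sum>K\<in>?S. if conj_into g L K then m K else 0) *
        (\<Sum>\<phi>\<in>dual H. \<Phi> (inv\<^bsub>?D\<^esub> \<phi>) * \<Psi> (conj_res g L \<phi>)) =
        (if xconj G A g (H, \<Phi>) = (L, \<Psi>) then of_nat (card (dual H)) else 0)"
    proof (cases "L = conj_set G g H")
      case True
      then show ?thesis
        unfolding mu using conj_character_orthogonality[OF fin_dual p q[unfolded q_eq] g True] by simp
    next
      case False
      then have "xconj G A g (H, \<Phi>) \<noteq> (L, \<Psi>)" by (auto simp: xconj_def)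
      then show ?thesis unfolding mu using False by simp
    qed
  qed simp
  also have "\<dots> = of_nat (card (dual H)) * of_nat (card {g \<in> carrier G. xconj G A g (H, \<Phi>) = (L, \<Psi>)})"
    using fin by (simp flip: sum.inter_filter)
  also have "\<dots> = of_nat (card (dual H)) *
      (if q \<in> orbit G (xconj G A) (H, \<Phi>) then of_nat (card (stabilizer G (xconj G A) (H, \<Phi>))) else 0)"
    unfolding card_transporter[OF p] q_eq by simp
  finally show ?thesis by (simp only: m_def)
qed

lemma prim_idem_eqI:
  fixes e :: "('g, 'a, 'k::field_char_0) burnside"
  assumes fin: "finite (carrier G)"
    and fin_dual: "\<And>U. subgroup U G \<Longrightarrow> finite (dual U)"
    and split: "\<And>U. subgroup U G \<Longrightarrow> splitting_field TYPE('k) (sub_dual G A U)"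
    and e: "e \<in> carrier (burnside_algebra TYPE('k) G A)"
    and species: "\<And>q. q \<in> xpairs G A \<Longrightarrow> species G q e = (if q \<in> orbit G (xconj G A) p then 1 else 0)"
  shows "prim_idem G A p = e"
  unfolding prim_idem_def
proof (rule the_equality)
  show "e \<in> carrier (burnside_algebra TYPE('k) G A) \<and>
      (\<forall>q\<in>xpairs G A. species G q e = (if q \<in> orbit G (xconj G A) p then 1 else 0))"
    using e species by blast
  fix f :: "('g, 'a, 'k) burnside"
  assume f: "f \<in> carrier (burnside_algebra TYPE('k) G A) \<and>
      (\<forall>q\<in>xpairs G A. species G q f = (if q \<in> orbit G (xconj G A) p then 1 else 0))"
  have "f - e = 0"
  proof (rule species_jointly_injective[OF fin fin_dual split])
    show "Poly_Mapping.keys (f - e) \<subseteq> orbits G (mpairs G A) (mconj G)"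
      using e f keys_diff[of f e] by (auto simp: burnside_algebra_def)
    show "species G q (f - e) = 0" if "q \<in> xpairs G A" for q
      using f species that by (simp add: species_diff)
  qed
  then show "f = e" by simp
qed

end

theorem theorem3p2:
  fixes G :: "('g, 'm) monoid_scheme" and A :: "('a, 'n) monoid_scheme"
    and H :: "'g set" and \<Phi> :: "('g \<Rightarrow> 'a) \<Rightarrow> 'k::field_char_0"
  assumes "group G" and "finite (carrier G)" and "comm_group A"
    and "\<And>U. subgroup U G \<Longrightarrow> finite (carrier (sub_dual G A U))"
    and "\<And>U. subgroup U G \<Longrightarrow> splitting_field TYPE('k) (sub_dual G A U)"
    and "(H, \<Phi>) \<in> xpairs G A"
  shows "prim_idem G A (H, \<Phi>) \<in> carrier (burnside_algebra TYPE('k) G A) \<and>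
    prim_idem G A (H, \<Phi>) =
      scale (1 / of_nat (card (stabilizer G (xconj G A) (H, \<Phi>))))
        (\<Sum>K | subgroup K (G\<lparr>carrier := H\<rparr>).
          scale (of_nat (card K) * of_int (moebius {U. subgroup U G} K H))
            (orbit_elem_lin G A K (dual_res K (dual_idem G A H \<Phi>)))) \<and>
    prim_idem G A (H, \<Phi>) =
      scale (1 / of_nat (card (stabilizer G (xconj G A) (H, \<Phi>))))
        (\<Sum>K | subgroup K (G\<lparr>carrier := H\<rparr>) \<and> (\<forall>\<phi>\<in>perp G A H K. \<Phi> \<phi> = 1).
          scale (of_nat (card K) * of_int (moebius {U. subgroup U G} K H))
            (orbit_elem_lin G A K (dual_res K (dual_idem G A H \<Phi>)))) \<and>
    prim_idem G A (H, \<Phi>) =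
      scale (1 / (of_nat (card (stabilizer G (xconj G A) (H, \<Phi>))) * of_nat (card (carrier (sub_dual G A H)))))
        (\<Sum>K | subgroup K (G\<lparr>carrier := H\<rparr>) \<and> (\<forall>\<phi>\<in>perp G A H K. \<Phi> \<phi> = 1).
          \<Sum>\<phi>\<in>carrier (sub_dual G A H).
            scale (of_nat (card K) * of_int (moebius {U. subgroup U G} K H) *
                   \<Phi> (inv\<^bsub>sub_dual G A H\<^esub> \<phi>))
              (orbit_elem G K (restrict \<phi> K)))"
proof -
  interpret fibered_group G A using assms(1,3) by (simp add: fibered_group_def)
  note fin = assms(2) and fin_dual = assms(4) and split = assms(5) and p = assms(6)
  have H: "subgroup H G" using p by (simp add: xpairs_iff)
  let ?S = "{K. subgroup K (G\<lparr>carrier := H\<rparr>)}"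
  let ?T = "{K. subgroup K (G\<lparr>carrier := H\<rparr>) \<and> (\<forall>\<phi>\<in>perp G A H K. \<Phi> \<phi> = 1)}"
  define N where "N = (of_nat (card (stabilizer G (xconj G A) (H, \<Phi>))) :: 'k)"
  define D where "D = (of_nat (card (dual H)) :: 'k)"
  define m where "m K = (of_nat (card K) * of_int (moebius {U. subgroup U G} K H) :: 'k)" for K
  define R where "R K = orbit_elem_lin G A K (dual_res K (dual_idem G A H \<Phi>))" for K
  have K: "subgroup K G" "K \<subseteq> H" if "subgroup K (G\<lparr>carrier := H\<rparr>)" for K
    using that by (simp_all add: subgroup_of_subgroup_iff[OF H])
  have finS: "finite ?S"
    by (simp add: subgroup_of_subgroup_iff[OF H] finite_subgroups[OF fin])
  have R: "R K = scale (1 / D) (twisted_sum H \<Phi> K)" if "subgroup K (G\<lparr>carrier := H\<rparr>)" for K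
    unfolding R_def D_def
    by (rule orbit_elem_lin_dual_res_dual_idem[OF fin_dual K]) (rule K that)+
  have D0: "D \<noteq> 0"
    using fin_dual[OF H] comm_group.axioms(1)[OF group_sub_dual[OF H]]
      monoid.one_closed[OF group.is_monoid[OF comm_group.axioms(2)[OF group_sub_dual[OF H]]]]
    by (auto simp: D_def)
  have N0: "N \<noteq> 0"
  proof -
    have "\<one>\<^bsub>G\<^esub> \<in> stabilizer G (xconj G A) (H, \<Phi>)"
      using xconj_one[OF p] by (simp add: stabilizer_def)
    moreover have "finite (stabilizer G (xconj G A) (H, \<Phi>))" using fin by (simp add: stabilizer_def)
    ultimately show ?thesis by (auto simp: N_def)
  qed
  define e where "e = scale (1 / (N * D)) (\<Sum>K\<in>?S. scale (m K) (twisted_sum H \<Phi> K))"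
  have e1: "e = scale (1 / N) (\<Sum>K\<in>?S. scale (m K) (R K))"
    by (simp add: e_def R scale_sum scale_simps mult.commute)
  have "(\<Sum>K\<in>?S. scale (m K) (twisted_sum H \<Phi> K)) = (\<Sum>K\<in>?T. scale (m K) (twisted_sum H \<Phi> K))"
  proof (rule sum.mono_neutral_right)
    show "\<forall>K\<in>?S - ?T. scale (m K) (twisted_sum H \<Phi> K) = 0"
      using twisted_sum_eq_zero[OF p K(2)] by (fastforce simp: scale_simps)
  qed (use finS in auto)
  then have e': "e = scale (1 / (N * D)) (\<Sum>K\<in>?T. scale (m K) (twisted_sum H \<Phi> K))"
    by (simp add: e_def)
  have e2: "e = scale (1 / N) (\<Sum>K\<in>?T. scale (m K) (R K))"
    by (simp add: e' R scale_sum scale_simps mult.commute)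
  have e3: "e = scale (1 / (N * D)) (\<Sum>K\<in>?T. \<Sum>\<phi>\<in>dual H.
      scale (m K * \<Phi> (inv\<^bsub>sub_dual G A H\<^esub> \<phi>)) (orbit_elem G K (restrict \<phi> K)))"
    by (simp add: e' twisted_sum_def scale_sum scale_simps)
  have "Poly_Mapping.keys e \<subseteq> orbits G (mpairs G A) (mconj G)"
    unfolding e_def twisted_sum_def
    by (intro order_trans[OF keys_scale] keys_sum_subset keys_orbit_elem restrict_in_dual)
      (use K in auto)
  then have e_carrier: "e \<in> carrier (burnside_algebra TYPE('k) G A)" by (simp add: burnside_algebra_def)
  have species_e: "species G q e = (if q \<in> orbit G (xconj G A) (H, \<Phi>) then 1 else 0)" if q: "q \<in> xpairs G A" for q
  proof -
    have "species G q e = 1 / (N * D) * species G q (\<Sum>K\<in>?S. scale (m K) (twisted_sum H \<Phi> K))"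
      unfolding e_def by (rule species_scale)
    also have "\<dots> = 1 / (N * D) * (D * (if q \<in> orbit G (xconj G A) (H, \<Phi>) then N else 0))"
      unfolding m_def D_def N_def species_moebius_sum[OF fin fin_dual[OF H] p q] ..
    finally show ?thesis using N0 D0 by simp
  qed
  have "prim_idem G A (H, \<Phi>) = e"
    by (rule prim_idem_eqI[OF fin fin_dual split e_carrier species_e])
  then show ?thesis
    using e_carrier e1 e2 e3 unfolding N_def D_def m_def R_def by simp
qed

end
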